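(* Assume $1 \leq p \leq \infty$ and $\psi \in L^p(\mathbb{R}^d)$ with $P|\psi| \in L^p_{loc}(\mathbb{R}^d)$. Then $S : \ell^1(\ell^p) \to L^p(\mathbb{R}^d)$ is bounded. More precisely, if $c \in \ell^1(\ell^p)$ then the series $$Sc = \sum_{j>0} \sum_{k \in \mathbb{Z}^d} c_{j,k} \psi_{j,k}$$ converges in $L^p$ in the sense that the sum over $k$ converges pointwise absolutely a.e. to a function in $L^p$, and the sum over $j$ converges absolutely in $L^p$; and furthermore $$\| Sc \|_p \leq |\det b|^{-1} \, \| P|\psi| \|_{L^p(b\mathcal{C})} \, \| c \|_{\ell^1(\ell^p)} .$$
   Context: Fix $d \in \mathbb{N}$. The dilation matrices $a_j$ ($j=1,2,3,\ldots$) are invertible $d \times d$ real matrices that are expanding: $\|a_j^{-1}\| \to 0$ as $j \to \infty$ (operator norm on $\mathbb{R}^d$). The translation matrix $b$ is an invertible $d \times d$ real matrix. $L^p=L^p(\mathbb{R}^d)$ consists of complex-valued functions. Sums over $j>0$ are over $j=1,2,3,\ldots$. For $\psi \in L^p$ put $\psi_{j,k}(x) = |\det a_j|^{1/p}\psi(a_j x - bk)$, $x \in \mathbb{R}^d$, $k \in \mathbb{Z}^d$ (with $1/\infty = 0$). For sequences $c=\{c_{j,k}\}_{j>0,k\in\mathbb{Z}^d}$ of complex numbers, $\|c\|_{\ell^1(\ell^p)} = \sum_{j>0} \big(\sum_{k\in\mathbb{Z}^d}|c_{j,k}|^p\big)^{1/p}$ if $1\le p<\infty$, and $\|c\|_{\ell^1(\ell^\infty)}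 = \sum_{j>0}\sup_{k}|c_{j,k}|$; $\ell^1(\ell^p)$ is the Banach space of sequences with finite norm. The periodization of a function $f$ is $Pf(x) = |\det b|\sum_{k\in\mathbb{Z}^d} f(x-bk)$. $\mathcal{C}=[0,1)^d$ and $b\mathcal{C} = \{bx : x\in\mathcal{C}\}$. *)

theory Defs
  imports "HOL-Analysis.Analysis" "HOL-Probability.Essential_Supremum"
begin

text \<open>Real powers of extended nonnegative reals, used only for exponents \<open>r > 0\<close>.\<close>

definition ennreal_rpow :: "ennreal \<Rightarrow> real \<Rightarrow> ennreal" where
  "ennreal_rpow u r = (if u = \<infinity> then \<infinity> else ennreal (enn2real u powr r))"

text \<open>The exponent \<open>p\<close> ranges over \<open>[1, \<infinity>]\<close>. Since \<open>enn2real \<infinity> = 0\<close> and \<open>1 / 0 = 0\<close>,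
  the real number below is \<open>1 / p\<close> with the convention \<open>1 / \<infinity> = 0\<close>.\<close>

definition recip_exp :: "ennreal \<Rightarrow> real" where
  "recip_exp p = 1 / enn2real p"

text \<open>\<open>L\<^sup>p\<close> norms are taken in \<open>[0, \<infinity>]\<close>. The version for \<open>[0, \<infinity>]\<close>-valued functions is needed
  because the periodization of \<open>\<bar>\<psi>\<bar>\<close> may be infinite at some points.\<close>

definition eLp_norm :: "ennreal \<Rightarrow> 'a measure \<Rightarrow> ('a \<Rightarrow> ennreal) \<Rightarrow> ennreal" where
  "eLp_norm p M g =
     (if p = \<infinity> then esssup M g
      else ennreal_rpow (\<integral>\<^sup>+x. ennreal_rpow (g x) (enn2real p) \<partial>M) (recip_exp p))"

definition Lp_norm :: "ennreal \<Rightarrow> 'a measure \<Rightarrow> ('a \<Rightarrow> complex) \<Rightarrow> ennreal" where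
  "Lp_norm p M f = eLp_norm p M (\<lambda>x. ennreal (cmod (f x)))"

definition Lp_space :: "ennreal \<Rightarrow> 'a measure \<Rightarrow> ('a \<Rightarrow> complex) set" where
  "Lp_space p M = {f \<in> borel_measurable M. Lp_norm p M f < \<infinity>}"

definition eLp_loc :: "ennreal \<Rightarrow> ('a::euclidean_space \<Rightarrow> ennreal) set" where
  "eLp_loc p = {g \<in> borel_measurable lebesgue.
     \<forall>K. compact K \<longrightarrow> eLp_norm p (lebesgue_on K) g < \<infinity>}"

text \<open>\<open>F\<close> is the sum in \<open>L\<^sup>p\<close> of the absolutely convergent series \<open>f 1 + f 2 + \<dots>\<close>.
  The value \<open>f 0\<close> is ignored.\<close>

definition Lp_abs_sums ::
  "ennreal \<Rightarrow> 'a measure \<Rightarrow> (nat \<Rightarrow> 'a \<Rightarrow> complex) \<Rightarrow> ('a \<Rightarrow> complex) \<Rightarrow> bool" where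
  "Lp_abs_sums p M f F \<longleftrightarrow>
     (\<forall>j>0. f j \<in> Lp_space p M) \<and>
     (\<Sum>\<^sub>\<infinity>j\<in>{0<..}. Lp_norm p M (f j)) < \<infinity> \<and>
     F \<in> Lp_space p M \<and>
     (\<lambda>N. Lp_norm p M (\<lambda>x. F x - (\<Sum>j=1..N. f j x))) \<longlonglongrightarrow> 0"

text \<open>Sequences on \<open>\<int>\<^sup>d\<close> and on \<open>{1, 2, \<dots>} \<times> \<int>\<^sup>d\<close>, with \<open>\<int>\<^sup>d\<close> rendered as \<open>int ^ 'n\<close>. A doubly
  indexed sequence has first index of type \<open>nat\<close>; its entries at \<open>0\<close> are ignored.\<close>

definition lp_norm :: "ennreal \<Rightarrow> ('k \<Rightarrow> complex) \<Rightarrow> ennreal" where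
  "lp_norm p s =
     (if p = \<infinity> then (SUP k. ennreal (cmod (s k)))
      else ennreal_rpow (\<Sum>\<^sub>\<infinity>k. ennreal (cmod (s k) powr enn2real p)) (recip_exp p))"

definition l1lp_norm :: "ennreal \<Rightarrow> (nat \<Rightarrow> 'k \<Rightarrow> complex) \<Rightarrow> ennreal" where
  "l1lp_norm p c = (\<Sum>\<^sub>\<infinity>j\<in>{0<..}. lp_norm p (c j))"

definition l1lp_space :: "ennreal \<Rightarrow> (nat \<Rightarrow> 'k \<Rightarrow> complex) set" where
  "l1lp_space p = {c. l1lp_norm p c < \<infinity>}"

definition int_vec :: "int ^ 'n \<Rightarrow> real ^ 'n" where
  "int_vec k = (\<chi> i. real_of_int (k $ i))"

definition unit_cube :: "(real ^ 'n) set" where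
  "unit_cube = {x. \<forall>i. 0 \<le> x $ i \<and> x $ i < 1}"

definition expanding :: "(nat \<Rightarrow> real ^ 'n ^ 'n) \<Rightarrow> bool" where
  "expanding a \<longleftrightarrow> (\<lambda>j. onorm (\<lambda>x. matrix_inv (a j) *v x)) \<longlonglongrightarrow> 0"

definition periodization ::
  "real ^ 'n ^ 'n \<Rightarrow> (real ^ 'n \<Rightarrow> ennreal) \<Rightarrow> real ^ 'n \<Rightarrow> ennreal" where
  "periodization b g x = ennreal \<bar>det b\<bar> * (\<Sum>\<^sub>\<infinity>k. g (x - b *v int_vec k))"

definition affine_atom ::
  "ennreal \<Rightarrow> (nat \<Rightarrow> real ^ 'n ^ 'n) \<Rightarrow> real ^ 'n ^ 'n \<Rightarrow> (real ^ 'n \<Rightarrow> complex)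
     \<Rightarrow> nat \<Rightarrow> int ^ 'n \<Rightarrow> real ^ 'n \<Rightarrow> complex" where
  "affine_atom p a b \<psi> j k x =
     of_real (\<bar>det (a j)\<bar> powr recip_exp p) * \<psi> (a j *v x - b *v int_vec k)"

definition synthesis_layer ::
  "ennreal \<Rightarrow> (nat \<Rightarrow> real ^ 'n ^ 'n) \<Rightarrow> real ^ 'n ^ 'n \<Rightarrow> (real ^ 'n \<Rightarrow> complex)
     \<Rightarrow> (nat \<Rightarrow> int ^ 'n \<Rightarrow> complex) \<Rightarrow> nat \<Rightarrow> real ^ 'n \<Rightarrow> complex" where
  "synthesis_layer p a b \<psi> c j x = (\<Sum>\<^sub>\<infinity>k. c j k * affine_atom p a b \<psi> j k x)"

text \<open>The sum over \<open>j\<close> is a limit in \<open>L\<^sup>p\<close>, so it determines \<open>S c\<close> only almost everywhere; a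
  representative is chosen.\<close>

definition synthesis ::
  "ennreal \<Rightarrow> (nat \<Rightarrow> real ^ 'n ^ 'n) \<Rightarrow> real ^ 'n ^ 'n \<Rightarrow> (real ^ 'n \<Rightarrow> complex)
     \<Rightarrow> (nat \<Rightarrow> int ^ 'n \<Rightarrow> complex) \<Rightarrow> real ^ 'n \<Rightarrow> complex" where
  "synthesis p a b \<psi> c = (SOME F. Lp_abs_sums p lebesgue (synthesis_layer p a b \<psi> c) F)"

text \<open>Bounded linear operators from \<open>\<ell>\<^sup>1(\<ell>\<^sup>p)\<close> to \<open>L\<^sup>p\<close>. Linearity is equality almost everywhere,
  that is, equality of elements of \<open>L\<^sup>p\<close>.\<close>

definition bounded_l1lp_Lp_operator ::
  "ennreal \<Rightarrow> 'a measure \<Rightarrow> ((nat \<Rightarrow> 'k \<Rightarrow> complex) \<Rightarrow> 'a \<Rightarrow> complex) \<Rightarrow> bool" where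
  "bounded_l1lp_Lp_operator p M T \<longleftrightarrow>
     (\<forall>c\<in>l1lp_space p. T c \<in> Lp_space p M) \<and>
     (\<forall>c\<in>l1lp_space p. \<forall>c'\<in>l1lp_space p.
        AE x in M. T (\<lambda>j k. c j k + c' j k) x = T c x + T c' x) \<and>
     (\<forall>z. \<forall>c\<in>l1lp_space p. AE x in M. T (\<lambda>j k. z * c j k) x = z * T c x) \<and>
     (\<exists>B::real. \<forall>c\<in>l1lp_space p. Lp_norm p M (T c) \<le> ennreal B * l1lp_norm p c)"

end

theory Submission
  imports Defs
begin

text \<open>Write \<open>Q(x) = \<Sum>\<^sub>k |\<psi>(x - bk)|\<close>, so that \<open>P|\<psi>| = |det b| Q\<close>. For \<open>p < \<infinity>\<close>,
  Hoelder's inequality gives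
  \<open>(\<Sum>\<^sub>k |c\<^sub>k| |\<psi>(x - bk)|)\<^sup>p \<le> (\<Sum>\<^sub>k |c\<^sub>k|\<^sup>p |\<psi>(x - bk)|) Q(x)\<^bsup>p-1\<^esup>\<close>. Since \<open>Q\<close> is
  \<open>b\<int>\<^sup>d\<close>-periodic, integrating over \<open>\<real>\<^sup>d\<close> and folding the integral back to the cell \<open>bC\<close> bounds the
  integral by \<open>\<parallel>c\<parallel>\<^sub>p\<^sup>p\<close> times the integral of \<open>Q\<^sup>p\<close> over \<open>bC\<close>. The dilation by \<open>a\<^sub>j\<close> is absorbed by the
  factor \<open>|det a\<^sub>j|\<^bsup>1/p\<^esup>\<close>, so every layer satisfies the same bound, and Minkowski's inequality together
  with the completeness of \<open>L\<^sup>p\<close> handles the sum over \<open>j\<close>.\<close>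

section \<open>Linear changes of variables for Lebesgue measure\<close>

text \<open>The folding succeeds because the power Q^(p-1) left over by Hoelder is itself periodic.
  Hence every k contributes the same integral of |\<psi>| Q^(p-1), and summing |\<psi>| over the
  translates of the cell restores the missing factor Q. For p = \<infinity> periodicity acts
  directly: the essential supremum of Q over the cell bounds Q almost everywhere on the whole space.

  All estimates are made in [0, \<infinity>], so finiteness never has to be known beforehand. Local
  integrability of P|\<psi>| makes the final constant finite, and absolute convergence almost
  everywhere is then read off from the finite norm of the sum of the moduli. The bound for one layer
  has the same constant for every j, which is why summability over j of the inner norms is enough.
  The representative of S c is an arbitrary choice, so linearity and the norm bound are first
  obtained for the iterated pointwise sum and then transferred almost everywhere.\<close>

text \<open>Boxes determine how a linear map scales measure. This serves the two generators,
  coordinate swaps and shears, whose determinant has modulus 1.\<close>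

lemma measure_matrix_image_unimodular:
  fixes A :: "real^'n^'n"
  assumes "\<And>a b. measure lebesgue ((*v) A ` cbox a b) = measure lebesgue (cbox a b)" "\<bar>det A\<bar> = 1"
  shows "\<forall>S\<in>lmeasurable. (*v) A ` S \<in> lmeasurable \<and>
    measure lebesgue ((*v) A ` S) = \<bar>det A\<bar> * measure lebesgue S"
proof
  fix S :: "(real^'n) set" assume S: "S \<in> lmeasurable"
  have "(*v) A ` S \<in> lmeasurable \<and> 1 * measure lebesgue S = measure lebesgue ((*v) A ` S)"
    by (rule measure_linear_sufficient[OF matrix_vector_mul_linear S]) (simp only: assms(1) mult_1)
  then show "(*v) A ` S \<in> lmeasurable \<and> measure lebesgue ((*v) A ` S) = \<bar>det A\<bar> * measure lebesgue S"
    by (simp only: assms(2) mult_1)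
qed

text \<open>The library states this only for well-ordered index types, because it computes the
  determinant of a shear by triangularity.\<close>

lemma measure_matrix_image:
  fixes A :: "real^'n^'n"
  assumes "S \<in> lmeasurable"
  shows "(*v) A ` S \<in> lmeasurable"
    and "measure lebesgue ((*v) A ` S) = \<bar>det A\<bar> * measure lebesgue S"
proof -
  let ?P = "\<lambda>A :: real^'n^'n. \<forall>S\<in>lmeasurable. (*v) A ` S \<in> lmeasurable \<and>
    measure lebesgue ((*v) A ` S) = \<bar>det A\<bar> * measure lebesgue S"
  have "?P A"
  proof (rule induct_matrix_elementary_alt[where P = ?P])
    fix A B :: "real^'n^'n" assume mult: "?P A" "?P B"
    have "(*v) (A ** B) ` S = (*v) A ` (*v) B ` S" for S :: "(real^'n) set"
      by (simp add: image_image matrix_vector_mul_assoc)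
    with mult show "?P (A ** B)"
      by (simp add: det_mul abs_mult)
  next
    fix A :: "real^'n^'n" and i assume zero_row: "row i A = 0"
    have "negligible ((*v) A ` S)" for S :: "(real^'n) set"
    proof (rule negligible_subset)
      show "negligible {x :: real^'n. x $ i = 0}"
        by (rule negligible_standard_hyperplane_cart)
      have "A $ i = 0"
        using zero_row by (simp add: row_def)
      then show "(*v) A ` S \<subseteq> {x. x $ i = 0}"
        by (auto simp: matrix_vector_mult_def)
    qed
    moreover have "det A = 0"
      using zero_row by (rule det_zero_row)
    ultimately show "?P A"
      by (simp add: negligible_imp_measure0 negligible_imp_measurable)
  next
    fix A :: "real^'n^'n" assume diagonal: "A $ i $ j = 0" if "i \<noteq> j" for i j
    have "A *v x = (\<chi> k. A $ k $ k * x $ k)" for x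
    proof -
      have "(\<Sum>j\<in>UNIV. A $ k $ j * x $ j) = A $ k $ k * x $ k" for k
        using diagonal by (subst sum.remove[of _ k]) (auto intro!: sum.neutral)
      then show ?thesis
        by (simp add: matrix_vector_mult_def)
    qed
    then have "(*v) A = (\<lambda>x. \<chi> k. A $ k $ k * x $ k)"
      by blast
    moreover have "det A = (\<Prod>k\<in>UNIV. A $ k $ k)"
      using diagonal by (rule det_diagonal)
    ultimately show "?P A"
      by (simp add: measurable_stretch measure_stretch)
  next
    fix m n :: 'n assume swap1: "m \<noteq> n"
    let ?t = "Transposition.transpose m n"
    let ?T = "(\<chi> i j. mat 1 $ i $ ?t j) :: real^'n^'n"
    have perm: "?t permutes UNIV"
      by (rule permutes_swap_id) auto
    have T: "?T *v x = (\<chi> i. x $ ?t i)" for x :: "real^'n"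
    proof -
      have "(\<Sum>j\<in>UNIV. (if i = ?t j then 1 else 0) * x $ j) = x $ ?t i" for i
      proof -
        have "i = ?t j \<longleftrightarrow> ?t i = j" for j
          by auto
        then show ?thesis
          by (simp add: if_distrib if_distribR cong: if_cong)
      qed
      then show ?thesis
        by (simp add: matrix_vector_mult_def mat_def)
    qed
    show "?P ?T"
    proof (rule measure_matrix_image_unimodular)
      fix a b :: "real^'n"
      \<comment> \<open>\<open>?T\<close> is an involution that permutes coordinates, so the image
        of a box is the box with permuted corners, and only the order of the side lengths
        changes.\<close>
      have im: "(*v) ?T ` cbox a b = cbox (?T *v a) (?T *v b)"
      proof (intro subset_antisym subsetI)
        fix y assume "y \<in> (*v) ?T ` cbox a b"
        then show "y \<in> cbox (?T *v a) (?T *v b)"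
          unfolding T by (auto simp: mem_box_cart)
      next
        fix y assume y: "y \<in> cbox (?T *v a) (?T *v b)"
        have "y = ?T *v (?T *v y)"
          unfolding T by simp
        moreover have "?T *v y \<in> cbox a b"
          unfolding mem_box_cart
        proof
          fix i
          show "a $ i \<le> (?T *v y) $ i \<and> (?T *v y) $ i \<le> b $ i"
            using y[unfolded mem_box_cart, rule_format, of "?t i"] by (simp add: T)
        qed
        ultimately show "y \<in> (*v) ?T ` cbox a b"
          by blast
      qed
      have "(\<Prod>i\<in>UNIV. b $ ?t i - a $ ?t i) = (\<Prod>i\<in>UNIV. b $ i - a $ i)"
        using prod.permute[OF perm, of "\<lambda>i. b $ i - a $ i"] by (simp add: o_def)
      moreover have "cbox (?T *v a) (?T *v b) = {} \<longleftrightarrow> cbox a b = {}"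
        unfolding im[symmetric] by simp
      ultimately show "measure lebesgue ((*v) ?T ` cbox a b) = measure lebesgue (cbox a b)"
        unfolding im by (simp add: content_cbox_if_cart T)
      show "\<bar>det ?T\<bar> = 1"
        using det_permute_columns[OF perm, of "mat 1 :: real^'n^'n"]
        by (simp add: sign_def)
    qed
  next
    fix m n :: 'n assume idplus: "m \<noteq> n"
    let ?E = "(\<chi> i j. of_bool (i = m \<and> j = n \<or> i = j)) :: real^'n^'n"
    have E: "?E *v x = (\<chi> i. if i = m then x $ m + x $ n else x $ i)" for x :: "real^'n"
    proof -
      have "(\<Sum>j\<in>UNIV. of_bool (i = m \<and> j = n \<or> i = j) * x $ j) =
        (\<Sum>j\<in>UNIV. (if j = i then x $ j else 0) + (if j = n then if i = m then x $ j else 0 else 0))" for i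
        using idplus by (intro sum.cong) auto
      then show ?thesis
        unfolding matrix_vector_mult_def vec_eq_iff vec_lambda_beta by (simp add: sum.distrib)
    qed
    show "?P ?E"
    proof (rule measure_matrix_image_unimodular)
      fix a b :: "real^'n"
      \<comment> \<open>\<open>measure_shear_interval\<close> asks for a box whose lower corner has
        a nonnegative n-th coordinate. Moving that corner to 0 provides this, and by linearity the
        image is translated along with the box.\<close>
      have shift: "cbox a b = (+) a ` cbox 0 (b - a)"
        using cbox_translation[of a 0 "b - a"] by simp
      then have "(*v) ?E ` cbox a b = (+) (?E *v a) ` (*v) ?E ` cbox 0 (b - a)"
        by (simp add: image_image matrix_vector_right_distrib)
      then have "measure lebesgue ((*v) ?E ` cbox a b) = measure lebesgue ((*v) ?E ` cbox 0 (b - a))"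
        by (simp add: measure_translation)
      also have "\<dots> = measure lebesgue (cbox 0 (b - a))"
      proof (cases "cbox 0 (b - a) = {}")
        case False
        then show ?thesis
          unfolding E by (intro measure_shear_interval[OF idplus]) auto
      qed simp
      also have "\<dots> = measure lebesgue (cbox a b)"
        unfolding shift by (rule measure_translation[symmetric])
      finally show "measure lebesgue ((*v) ?E ` cbox a b) = measure lebesgue (cbox a b)" .
      have "?E $ i $ j = (\<chi> k. if k = m then row m (mat 1) + 1 *s row n (mat 1) else row k (mat 1)) $ i $ j"
        for i j
        unfolding vec_lambda_beta using idplus by (auto simp: row_def mat_def)
      then have "?E = (\<chi> k. if k = m then row m (mat 1) + 1 *s row n (mat 1) else row k (mat 1))"
        unfolding vec_eq_iff by blast
      then have "det ?E = det (mat 1 :: real^'n^'n)"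
        using det_row_operation[OF idplus, of "mat 1 :: real^'n^'n" 1] by (simp only:)
      then show "\<bar>det ?E\<bar> = 1"
        by (simp only: det_I abs_one)
    qed
  qed
  from bspec[OF this assms] show "(*v) A ` S \<in> lmeasurable"
    "measure lebesgue ((*v) A ` S) = \<bar>det A\<bar> * measure lebesgue S"
    by (rule conjunct1, rule conjunct2)
qed

lemma matrix_image_sets_lebesgue:
  fixes A :: "real^'n^'n"
  assumes "S \<in> sets lebesgue"
  shows "(*v) A ` S \<in> sets lebesgue"
  using assms
  by (intro differentiable_image_in_sets_lebesgue linear_imp_differentiable_on matrix_vector_mul_linear) auto

lemma matrix_inverse_exE:
  fixes A :: "real^'n^'n"
  assumes "det A \<noteq> 0"
  obtains B where "\<And>x. A *v (B *v x) = x" "\<And>x. B *v (A *v x) = x" "det B = inverse (det A)"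
proof -
  obtain B where B: "A ** B = mat 1" "B ** A = mat 1"
    using assms by (auto simp: invertible_det_nz[symmetric] invertible_def)
  have "det A * det B = 1"
    by (simp flip: det_mul add: B)
  with assms have "det B = inverse (det A)"
    by (simp add: field_simps)
  with B show thesis
    by (intro that) (simp_all add: matrix_vector_mul_assoc)
qed

lemma emeasure_matrix_image:
  fixes A :: "real^'n^'n"
  assumes S: "S \<in> sets lebesgue" and A: "det A \<noteq> 0"
  shows "emeasure lebesgue ((*v) A ` S) = ennreal \<bar>det A\<bar> * emeasure lebesgue S"
proof (cases "S \<in> lmeasurable")
  case True
  then show ?thesis
    using measure_matrix_image[OF True, of A] by (simp add: emeasure_eq_measure2 ennreal_mult)
next
  case False
  then have inf: "emeasure lebesgue S = \<infinity>"
    using S by (auto simp: fmeasurable_def less_top[symmetric])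
  \<comment> \<open>If the image had finite measure, the inverse matrix would map it back to
    \<open>S\<close> and make \<open>S\<close> finite as well.\<close>
  have "(*v) A ` S \<notin> lmeasurable"
  proof
    assume "(*v) A ` S \<in> lmeasurable"
    moreover obtain B where "\<And>x. B *v (A *v x) = x"
      using matrix_inverse_exE[OF A] by metis
    ultimately show False
      using measure_matrix_image(1)[of "(*v) A ` S" B] False by (simp add: image_image)
  qed
  then have "emeasure lebesgue ((*v) A ` S) = \<infinity>"
    using matrix_image_sets_lebesgue[OF S, of A] by (auto simp: fmeasurable_def less_top[symmetric])
  with inf A show ?thesis
    by (simp add: ennreal_mult_top)
qed

text \<open>Measurability and push-forward measures concern preimages, while the measure formulas
  above concern images; the inverse matrix converts one into the other.\<close>

lemma vimage_affine:
  fixes A B :: "real^'n^'n"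
  assumes "\<And>x. A *v (B *v x) = x" "\<And>x. B *v (A *v x) = x"
  shows "(\<lambda>x. A *v x + v) -` S = (*v) B ` (+) (- v) ` S"
proof (intro subset_antisym subsetI)
  fix x assume "x \<in> (\<lambda>x. A *v x + v) -` S"
  then show "x \<in> (*v) B ` (+) (- v) ` S"
    using assms by (intro image_eqI[where x = "A *v x"] image_eqI[where x = "A *v x + v"]) auto
qed (use assms in auto)

lemma measurable_affine_lebesgue:
  fixes A :: "real^'n^'n"
  assumes "det A \<noteq> 0"
  shows "(\<lambda>x. A *v x + v) \<in> lebesgue \<rightarrow>\<^sub>M lebesgue"
proof (rule measurableI)
  fix S :: "(real^'n) set" assume "S \<in> sets lebesgue"
  then have S: "(+) (- v) ` S \<in> sets lebesgue"
    by (rule lebesgue_sets_translation)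
  obtain B where B: "\<And>x. A *v (B *v x) = x" "\<And>x. B *v (A *v x) = x"
    using matrix_inverse_exE[OF assms] by metis
  show "(\<lambda>x. A *v x + v) -` S \<inter> space lebesgue \<in> sets lebesgue"
    using matrix_image_sets_lebesgue[OF S, of B] by (simp add: vimage_affine[OF B])
qed simp

lemma distr_lebesgue_affine:
  fixes A :: "real^'n^'n"
  assumes A: "det A \<noteq> 0"
  shows "distr lebesgue lebesgue (\<lambda>x. A *v x + v) = scale_measure (ennreal (inverse \<bar>det A\<bar>)) lebesgue"
proof (rule measure_eqI)
  fix S assume "S \<in> sets (distr lebesgue lebesgue (\<lambda>x. A *v x + v))"
  then have S: "S \<in> sets lebesgue" by simp
  obtain B where B: "\<And>x. A *v (B *v x) = x" "\<And>x. B *v (A *v x) = x" "det B = inverse (det A)"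
    using matrix_inverse_exE[OF A] by metis
  have "emeasure lebesgue ((+) (- v) ` S) = emeasure lebesgue S"
    using emeasure_lebesgue_affine[of 1 "- v" S] by (simp add: add.commute[of _ "- v"])
  then show "emeasure (distr lebesgue lebesgue (\<lambda>x. A *v x + v)) S =
      emeasure (scale_measure (ennreal (inverse \<bar>det A\<bar>)) lebesgue) S"
    using S A B(3) lebesgue_sets_translation[OF S, of "- v"]
    by (simp add: emeasure_distr measurable_affine_lebesgue vimage_affine[OF B(1,2)]
        emeasure_matrix_image del: emeasure_completion)
qed simp

lemma nn_integral_lebesgue_affine:
  fixes A :: "real^'n^'n"
  assumes "det A \<noteq> 0" and "g \<in> borel_measurable lebesgue"
  shows "(\<integral>\<^sup>+x. g (A *v x + v) \<partial>lebesgue) = ennreal (inverse \<bar>det A\<bar>) * (\<integral>\<^sup>+x. g x \<partial>lebesgue)"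
  using assms
  by (simp flip: nn_integral_distr[OF measurable_affine_lebesgue, of A g v]
      add: distr_lebesgue_affine nn_integral_scale_measure)

lemma AE_lebesgue_affine:
  fixes A :: "real^'n^'n"
  assumes A: "det A \<noteq> 0" and "AE x in lebesgue. P x"
  shows "AE x in lebesgue. P (A *v x + v)"
proof -
  obtain N where N: "{x. \<not> P x} \<subseteq> N" "N \<in> null_sets lebesgue"
    using assms(2) by (elim AE_E3) auto
  then have "N \<in> null_sets (distr lebesgue lebesgue (\<lambda>x. A *v x + v))"
    unfolding distr_lebesgue_affine[OF A] by (auto simp: null_sets_def)
  then have "AE x in distr lebesgue lebesgue (\<lambda>x. A *v x + v). P x"
    using N(1) by (auto intro: AE_I')
  then show ?thesis
    by (rule AE_distrD[OF measurable_affine_lebesgue[OF A]])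
qed

section \<open>Countable sums and real powers in the extended nonnegative reals\<close>

text \<open>Links the unordered sums of the definitions to integrals over counting measure, for
  which Tonelli, monotone convergence and Hoelder are available. Both sides are suprema of finite
  partial sums.\<close>

lemma infsum_ennreal_eq_nn_integral:
  fixes f :: "'a \<Rightarrow> ennreal"
  assumes "countable A"
  shows "infsum f A = (\<integral>\<^sup>+x. f x \<partial>count_space A)"
proof -
  have finite_sum: "sum f F = (\<integral>\<^sup>+x. f x * indicator F x \<partial>count_space A)"
    if "finite F" "F \<subseteq> A" for F
    using that by (subst nn_integral_count_space'[of F]) (auto simp: indicator_def)
  have inf: "infsum f A = (SUP F\<in>{F. finite F \<and> F \<subseteq> A}. sum f F)"
    by (rule nonneg_infsum_complete) simp
  \<comment> \<open>An increasing exhaustion of \<open>A\<close> by finite sets, read off from an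
    enumeration. It turns the supremum over all finite subsets into one along a sequence.\<close>
  define E where "E n = {x \<in> A. to_nat_on A x < n}" for n
  have E: "finite (E n)" "E n \<subseteq> A" for n
  proof -
    have "inj_on (to_nat_on A) (E n)"
      using inj_on_to_nat_on[OF assms] by (rule inj_on_subset) (auto simp: E_def)
    then show "finite (E n)"
      by (rule inj_on_finite[of _ _ "{..<n}"]) (auto simp: E_def)
  qed (auto simp: E_def)
  have "(SUP n. f x * indicator (E n) x) = f x" if "x \<in> A" for x
  proof (rule SUP_eqI)
    fix y assume *: "\<And>n. n \<in> UNIV \<Longrightarrow> f x * indicator (E n) x \<le> y"
    show "f x \<le> y"
      using *[of "Suc (to_nat_on A x)"] that by (simp add: E_def)
  qed (auto simp: indicator_def)
  then have "(\<integral>\<^sup>+x. f x \<partial>count_space A) = (\<integral>\<^sup>+x. (SUP n. f x * indicator (E n) x) \<partial>count_space A)"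
    by (intro nn_integral_cong) simp
  also have "\<dots> = (SUP n. \<integral>\<^sup>+x. f x * indicator (E n) x \<partial>count_space A)"
    by (intro nn_integral_monotone_convergence_SUP)
      (auto simp: incseq_def le_fun_def indicator_def E_def)
  also have "\<dots> = (SUP n. sum f (E n))"
    using E by (simp add: finite_sum)
  finally have "(\<integral>\<^sup>+x. f x \<partial>count_space A) = (SUP n. sum f (E n))" .
  moreover have "\<dots> \<le> infsum f A"
    unfolding inf using E by (intro SUP_least SUP_upper) auto
  moreover have "infsum f A \<le> (\<integral>\<^sup>+x. f x \<partial>count_space A)"
    unfolding inf
    by (intro SUP_least) (auto simp: finite_sum intro!: nn_integral_mono simp: indicator_def)
  ultimately show ?thesis
    by simp
qed

lemma summable_norm_iff_nn_integral:
  fixes f :: "'a \<Rightarrow> complex"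
  shows "(\<lambda>x. cmod (f x)) summable_on A \<longleftrightarrow> (\<integral>\<^sup>+x. ennreal (cmod (f x)) \<partial>count_space A) < \<infinity>"
  unfolding abs_summable_equivalent abs_summable_on_def integrable_iff_bounded by simp

text \<open>In the complex numbers summability is the same as absolute summability, hence
  integrability for counting measure; where it fails, both sides have the default value 0.\<close>

lemma infsum_eq_lebesgue_integral:
  fixes f :: "'a \<Rightarrow> complex"
  shows "infsum f A = lebesgue_integral (count_space A) f"
proof (cases "integrable (count_space A) f")
  case True
  then show ?thesis
    using infsetsum_infsum[of f A] by (simp add: abs_summable_on_def infsetsum_def)
next
  case False
  then have "\<not> f summable_on A"
    by (simp add: summable_on_iff_abs_summable_on_complex abs_summable_equivalent abs_summable_on_def)
  with False show ?thesis
    by (simp add: infsum_not_exists not_integrable_integral_eq)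
qed

text \<open>Divergent sums are covered too, since \<open>infsum\<close> is then 0. The bound can
  therefore be applied at every point x before convergence has been established.\<close>

lemma norm_infsum_le_nn_integral:
  fixes f :: "'a \<Rightarrow> complex"
  shows "ennreal (cmod (infsum f A)) \<le> (\<integral>\<^sup>+x. ennreal (cmod (f x)) \<partial>count_space A)"
proof (cases "integrable (count_space A) f")
  case True
  then show ?thesis
    unfolding infsum_eq_lebesgue_integral by (rule integral_norm_bound_ennreal)
qed (simp add: infsum_eq_lebesgue_integral not_integrable_integral_eq)

text \<open>The sum is a parameter integral over counting measure, which is sigma-finite on a
  countable index set; joint measurability follows because the index takes countably many
  values.\<close>

lemma borel_measurable_infsum_complex:
  fixes f :: "'k \<Rightarrow> 'a \<Rightarrow> complex"
  assumes "countable A" "\<And>k. k \<in> A \<Longrightarrow> f k \<in> borel_measurable M"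
  shows "(\<lambda>x. infsum (\<lambda>k. f k x) A) \<in> borel_measurable M"
proof -
  interpret sigma_finite_measure "count_space A"
    using assms(1) by (rule sigma_finite_measure_count_space_countable)
  have "(\<lambda>z. f (snd z) (fst z)) \<in> borel_measurable (M \<Otimes>\<^sub>M count_space A)"
    using assms
    by (intro measurable_compose_countable'[where I = A and g = snd and f = "\<lambda>k z. f k (fst z)"])
      (auto intro: measurable_compose[OF measurable_fst])
  then show ?thesis
    unfolding infsum_eq_lebesgue_integral
    by (intro borel_measurable_lebesgue_integral) (simp add: case_prod_unfold)
qed

lemma borel_measurable_nn_integral_count_space:
  fixes f :: "'k \<Rightarrow> 'a \<Rightarrow> ennreal"
  assumes "countable A" "\<And>k. k \<in> A \<Longrightarrow> f k \<in> borel_measurable M"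
  shows "(\<lambda>x. \<integral>\<^sup>+k. f k x \<partial>count_space A) \<in> borel_measurable M"
proof -
  interpret sigma_finite_measure "count_space A"
    using assms(1) by (rule sigma_finite_measure_count_space_countable)
  have "(\<lambda>z. f (snd z) (fst z)) \<in> borel_measurable (M \<Otimes>\<^sub>M count_space A)"
    using assms
    by (intro measurable_compose_countable'[where I = A and g = snd and f = "\<lambda>k z. f k (fst z)"])
      (auto intro: measurable_compose[OF measurable_fst])
  then show ?thesis
    by (intro borel_measurable_nn_integral) (simp add: case_prod_unfold)
qed

section \<open>Real powers in [0, \<infinity>] and Hoelder's inequality\<close>

lemma ennreal_rpow_ennreal [simp]: "0 \<le> x \<Longrightarrow> ennreal_rpow (ennreal x) r = ennreal (x powr r)"
  by (simp add: ennreal_rpow_def)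

lemma ennreal_rpow_0 [simp]: "ennreal_rpow 0 r = 0"
  by (simp add: ennreal_rpow_def)

lemma ennreal_rpow_top [simp]: "ennreal_rpow \<infinity> r = \<infinity>" "ennreal_rpow top r = top"
  by (simp_all add: ennreal_rpow_def)

lemma ennreal_rpow_eq_0_iff [simp]: "ennreal_rpow u r = 0 \<longleftrightarrow> u = 0"
  by (cases u) auto

lemma ennreal_rpow_eq_top_iff [simp]: "ennreal_rpow u r = top \<longleftrightarrow> u = top"
  by (cases u) auto

lemma ennreal_rpow_1 [simp]: "ennreal_rpow u 1 = u"
  by (cases u) auto

lemma ennreal_rpow_mono: "0 \<le> r \<Longrightarrow> u \<le> v \<Longrightarrow> ennreal_rpow u r \<le> ennreal_rpow v r"
  by (cases u; cases v) (auto intro: ennreal_leI powr_mono2 simp: top_unique)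

lemma ennreal_rpow_mult: "ennreal_rpow (u * v) r = ennreal_rpow u r * ennreal_rpow v r"
proof (cases "u = top \<or> v = top")
  case True
  then show ?thesis
    by (cases "u = 0 \<or> v = 0") (auto simp: ennreal_mult_eq_top_iff ennreal_mult_top ennreal_top_mult)
next
  case False
  then show ?thesis
    by (cases u; cases v) (auto simp: powr_mult simp flip: ennreal_mult)
qed

lemma ennreal_rpow_rpow: "ennreal_rpow (ennreal_rpow u r) s = ennreal_rpow u (r * s)"
  by (cases u) (auto simp: powr_powr)

text \<open>The end points 0 and \<infinity> are fixed by \<open>ennreal_rpow\<close> for every
  exponent, including 0. So the identity survives for \<open>r = 1\<close>, and the exponent p = 1
  needs no separate argument later.\<close>

lemma ennreal_mult_rpow_diff_1: "u * ennreal_rpow u (r - 1) = ennreal_rpow u r"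
  by (cases u) (auto simp: powr_mult_base ennreal_mult_eq_top_iff simp flip: ennreal_mult)

lemma borel_measurable_ennreal_rpow [measurable]:
  assumes [measurable]: "f \<in> borel_measurable M"
  shows "(\<lambda>x. ennreal_rpow (f x) r) \<in> borel_measurable M"
  unfolding ennreal_rpow_def by measurable

text \<open>Hoelder's inequality for the measure \<open>w\<close>, in a form that needs no finiteness assumption; the
  proof integrates Young's inequality \<open>c \<le> t\<^bsup>1-r\<^esup> c\<^bsup>r\<^esup> / r + (1 - 1/r) t\<close> for the optimal \<open>t\<close>.\<close>

lemma nn_integral_mult_rpow_le:
  assumes [measurable]: "c \<in> borel_measurable M" "w \<in> borel_measurable M" and r: "1 \<le> r"
  shows "ennreal_rpow (\<integral>\<^sup>+x. c x * w x \<partial>M) r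
    \<le> (\<integral>\<^sup>+x. ennreal_rpow (c x) r * w x \<partial>M) * ennreal_rpow (\<integral>\<^sup>+x. w x \<partial>M) (r - 1)"
    (is "_ \<le> ?m * ennreal_rpow ?w _")
proof -
  \<comment> \<open>Vanishing factors come first because \<open>0 * top = 0\<close>: an infinite
    factor makes the right-hand side infinite only if the other factor is nonzero.\<close>
  consider "?w = 0" | "?m = 0" | "?w \<noteq> 0" "?m \<noteq> 0" "?w = top \<or> ?m = top"
    | "?w \<noteq> 0" "?m \<noteq> 0" "?w \<noteq> top" "?m \<noteq> top"
    by blast
  then show ?thesis
  proof cases
    case 1
    then have "AE x in M. w x = 0"
      by (simp add: nn_integral_0_iff_AE)
    then have "(\<integral>\<^sup>+x. c x * w x \<partial>M) = 0"
      by (subst nn_integral_0_iff_AE) auto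
    then show ?thesis by simp
  next
    case 2
    then have "AE x in M. c x * w x = 0"
      by (subst (asm) nn_integral_0_iff_AE) auto
    then have "(\<integral>\<^sup>+x. c x * w x \<partial>M) = 0"
      by (subst nn_integral_0_iff_AE) auto
    then show ?thesis by simp
  next
    case 3
    then have "?m * ennreal_rpow ?w (r - 1) = top"
      by (auto simp: ennreal_mult_eq_top_iff)
    then show ?thesis by simp
  next
    case 4
    then obtain m W where m: "?m = ennreal m" "0 < m" and W: "?w = ennreal W" "0 < W"
      by (cases ?m; cases ?w) (auto simp: less_le)
    \<comment> \<open>This t minimises the integrated Young bound
      \<open>t powr (1 - r) / r * m + (1 - 1 / r) * t * W\<close>; by
      \<open>t powr r = m / W\<close> its two terms add up to \<open>t * W\<close>.\<close>
    define t where "t = (m / W) powr (1 / r)"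
    have t: "0 < t" "t powr r = m / W"
      using m W r by (auto simp: t_def powr_powr)
    have ennreal_affine: "ennreal (a * b + d) = ennreal a * ennreal b + ennreal d"
      "ennreal (a * b + d * e) = ennreal a * ennreal b + ennreal d * ennreal e"
      if "0 \<le> a" "0 \<le> b" "0 \<le> d" "0 \<le> e" for a b d e
      using that by (simp_all add: ennreal_mult)
    have young: "c x \<le> ennreal (t powr (1 - r) / r) * ennreal_rpow (c x) r + ennreal ((1 - 1 / r) * t)" for x
    proof (cases "c x")
      case (real u)
      show ?thesis
      proof (cases "u = 0")
        case False
        \<comment> \<open>Weighted arithmetic-geometric mean for the numbers
          \<open>u powr r * t powr (1 - r)\<close> and \<open>t\<close> with weights
          \<open>1 / r\<close> and \<open>1 - 1 / r\<close>; the powers of t cancel and the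
          geometric mean is u.\<close>
        have "(u powr r * t powr (1 - r)) powr (1 / r) * t powr (1 - 1 / r)
            \<le> 1 / r * (u powr r * t powr (1 - r)) + (1 - 1 / r) * t"
          using False real r t by (intro Youngs_inequality_0) auto
        moreover have "(u powr r * t powr (1 - r)) powr (1 / r) * t powr (1 - 1 / r) = u"
        proof -
          have "(1 - r) * (1 / r) + (1 - 1 / r) = 0"
            using r by (simp add: field_simps)
          then have "t powr ((1 - r) * (1 / r)) * t powr (1 - 1 / r) = 1"
            using t by (simp flip: powr_add)
          then show ?thesis
            using False real r t by (simp add: powr_mult powr_powr)
        qed
        ultimately have "ennreal u \<le> ennreal (t powr (1 - r) / r * u powr r + (1 - 1 / r) * t)"
          by (intro ennreal_leI) (simp add: mult_ac)
        also have "\<dots> = ennreal (t powr (1 - r) / r) * ennreal (u powr r) + ennreal ((1 - 1 / r) * t)"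
          using r t by (intro ennreal_affine(1)[where e = 0]) auto
        finally show ?thesis
          using real by simp
      qed (use real in simp)
    next
      case top
      then show ?thesis
        using r t by (simp add: ennreal_mult_top)
    qed
    have "(\<integral>\<^sup>+x. c x * w x \<partial>M)
        \<le> (\<integral>\<^sup>+x. ennreal (t powr (1 - r) / r) * (ennreal_rpow (c x) r * w x) + ennreal ((1 - 1 / r) * t) * w x \<partial>M)"
    proof (rule nn_integral_mono)
      fix x
      show "c x * w x \<le> ennreal (t powr (1 - r) / r) * (ennreal_rpow (c x) r * w x) + ennreal ((1 - 1 / r) * t) * w x"
        using mult_right_mono[OF young[of x], of "w x"] by (simp add: distrib_right mult.assoc)
    qed
    also have "\<dots> = ennreal (t powr (1 - r) / r) * ?m + ennreal ((1 - 1 / r) * t) * ?w"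
      by (simp add: nn_integral_add nn_integral_cmult)
    also have "\<dots> = ennreal (t powr (1 - r) / r * m + (1 - 1 / r) * t * W)"
      unfolding m W using m W r t by (intro ennreal_affine(2)[symmetric]) auto
    also have "t powr (1 - r) / r * m + (1 - 1 / r) * t * W = t * W"
    proof -
      have "m = t powr r * W"
        using t W by simp
      moreover have "t powr (1 - r) * t powr r = t"
        by (subst powr_add[symmetric]) (use t(1) in simp)
      ultimately have "t powr (1 - r) * m = t * W"
        by (metis mult.assoc)
      then show ?thesis
        using r by (simp add: field_simps)
    qed
    finally have "ennreal_rpow (\<integral>\<^sup>+x. c x * w x \<partial>M) r \<le> ennreal_rpow (ennreal (t * W)) r"
      using r by (intro ennreal_rpow_mono) auto
    also have "\<dots> = ennreal (m * W powr (r - 1))"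
    proof -
      have "(t * W) powr r = m * W powr (r - 1)"
        using t W by (simp add: powr_mult powr_diff field_simps)
      then show ?thesis
        using t W by simp
    qed
    also have "\<dots> = ?m * ennreal_rpow ?w (r - 1)"
      using m W by (simp add: ennreal_mult)
    finally show ?thesis .
  qed
qed

section \<open>Extended norms and Minkowski's inequality for countable sums\<close>

lemma eLp_norm_top [simp]: "eLp_norm \<infinity> M g = esssup M g" "eLp_norm top M g = esssup M g"
  by (simp_all add: eLp_norm_def)

lemma exponent_cases:
  fixes p :: ennreal
  assumes "1 \<le> p"
  obtains "p = \<infinity>" | r where "1 \<le> r" "p = ennreal r" "recip_exp p = 1 / r" "enn2real p = r"
proof (cases p)
  case (real r)
  with assms have "1 \<le> r" by simp
  with real that(2)[of r] show thesis
    by (simp add: recip_exp_def)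
qed (use that(1) in simp)

lemma eLp_norm_ennreal:
  "0 \<le> r \<Longrightarrow> eLp_norm (ennreal r) M g = ennreal_rpow (\<integral>\<^sup>+x. ennreal_rpow (g x) r \<partial>M) (1 / r)"
  by (simp add: eLp_norm_def recip_exp_def)

lemma eLp_norm_rpow:
  "0 < r \<Longrightarrow> ennreal_rpow (eLp_norm (ennreal r) M g) r = (\<integral>\<^sup>+x. ennreal_rpow (g x) r \<partial>M)"
  by (simp add: eLp_norm_ennreal ennreal_rpow_rpow)

lemma eLp_norm_le_iff:
  assumes "0 < r"
  shows "eLp_norm (ennreal r) M g \<le> v \<longleftrightarrow> (\<integral>\<^sup>+x. ennreal_rpow (g x) r \<partial>M) \<le> ennreal_rpow v r"
proof
  assume "eLp_norm (ennreal r) M g \<le> v"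
  then have "ennreal_rpow (eLp_norm (ennreal r) M g) r \<le> ennreal_rpow v r"
    using assms by (intro ennreal_rpow_mono) auto
  then show "(\<integral>\<^sup>+x. ennreal_rpow (g x) r \<partial>M) \<le> ennreal_rpow v r"
    using assms by (simp add: eLp_norm_rpow)
next
  assume "(\<integral>\<^sup>+x. ennreal_rpow (g x) r \<partial>M) \<le> ennreal_rpow v r"
  then have "eLp_norm (ennreal r) M g \<le> ennreal_rpow (ennreal_rpow v r) (1 / r)"
    using assms unfolding eLp_norm_ennreal[OF less_imp_le[OF assms]] by (intro ennreal_rpow_mono) auto
  then show "eLp_norm (ennreal r) M g \<le> v"
    using assms by (simp add: ennreal_rpow_rpow)
qed

lemma eLp_norm_mono_AE:
  assumes "1 \<le> p" "f \<in> borel_measurable M" "AE x in M. f x \<le> g x"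
  shows "eLp_norm p M f \<le> eLp_norm p M g"
  using assms(1)
proof (cases rule: exponent_cases)
  case 1
  with assms show ?thesis
    by (simp add: esssup_AE_mono)
next
  case (2 r)
  have "(\<integral>\<^sup>+x. ennreal_rpow (f x) r \<partial>M) \<le> (\<integral>\<^sup>+x. ennreal_rpow (g x) r \<partial>M)"
    using assms(3) 2(1) by (intro nn_integral_mono_AE) (auto elim!: eventually_mono intro: ennreal_rpow_mono)
  with 2(1) show ?thesis
    by (simp add: 2(2) eLp_norm_ennreal ennreal_rpow_mono)
qed

lemma eLp_norm_cong_AE:
  assumes "1 \<le> p" "f \<in> borel_measurable M" "g \<in> borel_measurable M" "AE x in M. f x = g x"
  shows "eLp_norm p M f = eLp_norm p M g"
  using assms by (intro antisym eLp_norm_mono_AE) auto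

lemma eLp_norm_cmult_le:
  assumes p: "1 \<le> p" and [measurable]: "f \<in> borel_measurable M"
  shows "eLp_norm p M (\<lambda>x. c * f x) \<le> c * eLp_norm p M f"
  using p
proof (cases rule: exponent_cases)
  case 1
  have "AE x in M. c * f x \<le> c * esssup M f"
    using esssup_AE[of f M] by eventually_elim (simp add: mult_left_mono)
  with 1 show ?thesis
    by auto
next
  case (2 r)
  then show ?thesis
    unfolding 2(2) by (subst eLp_norm_le_iff) (auto simp: ennreal_rpow_mult nn_integral_cmult eLp_norm_rpow)
qed

text \<open>For finite exponents no duality is used. Each function is factored as
  \<open>f i = g i * \<alpha> i\<close> with \<open>\<alpha> i\<close> its norm, so that
  \<open>g i\<close> has norm at most 1. Hoelder over the index set with weights
  \<open>\<alpha> i\<close> of total mass \<open>A\<close> bounds the r-th power of the sum by the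
  sum of \<open>ennreal_rpow (g i x) r * \<alpha> i\<close>, times
  \<open>ennreal_rpow A (r - 1)\<close>. Integrating in x leaves at most \<open>A\<close> for the
  first factor.\<close>

lemma eLp_norm_nn_integral_count_space_le:
  fixes f :: "'i \<Rightarrow> 'a \<Rightarrow> ennreal"
  assumes p: "1 \<le> p" and I: "countable I" and f: "\<And>i. i \<in> I \<Longrightarrow> f i \<in> borel_measurable M"
  shows "eLp_norm p M (\<lambda>x. \<integral>\<^sup>+i. f i x \<partial>count_space I) \<le> (\<integral>\<^sup>+i. eLp_norm p M (f i) \<partial>count_space I)"
  using p
proof (cases rule: exponent_cases)
  case 1
  have "AE x in M. \<forall>i\<in>I. f i x \<le> esssup M (f i)"
    using I by (simp add: AE_ball_countable esssup_AE)
  then have "AE x in M. (\<integral>\<^sup>+i. f i x \<partial>count_space I) \<le> (\<integral>\<^sup>+i. esssup M (f i) \<partial>count_space I)"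
    by eventually_elim (auto intro!: nn_integral_mono)
  with 1 show ?thesis
    using borel_measurable_nn_integral_count_space[OF I f] by auto
next
  case (2 r)
  define \<alpha> where "\<alpha> i = eLp_norm p M (f i)" for i
  define A where "A = (\<integral>\<^sup>+i. \<alpha> i \<partial>count_space I)"
  have \<alpha>: "(\<integral>\<^sup>+x. ennreal_rpow (f i x) r \<partial>M) = ennreal_rpow (\<alpha> i) r" for i
    using 2(1) by (simp add: \<alpha>_def 2(2) eLp_norm_rpow)
  have "(\<integral>\<^sup>+x. ennreal_rpow (\<integral>\<^sup>+i. f i x \<partial>count_space I) r \<partial>M) \<le> ennreal_rpow A r"
  proof (cases "A = top")
    case False
    have finite: "\<alpha> i \<noteq> top" if "i \<in> I" for i
    proof -
      have "\<alpha> i * emeasure (count_space I) {i} \<le> (\<integral>\<^sup>+j. \<alpha> i * indicator {i} j \<partial>count_space I)"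
        using that by (simp add: nn_integral_cmult)
      also have "\<dots> \<le> A"
        unfolding A_def by (intro nn_integral_mono) (auto simp: indicator_def)
      finally show ?thesis
        using False that by (auto simp: top_unique)
    qed
    \<comment> \<open>\<open>f i / \<alpha> i\<close>; for \<open>\<alpha> i = 0\<close> the product is \<open>0\<close> wherever \<open>f i x = 0\<close>,
      since \<open>inverse 0 = \<infinity>\<close> and \<open>0 * \<infinity> = 0\<close>.\<close>
    define g where "g i x = f i x * inverse (\<alpha> i)" for i x
    have g: "g i \<in> borel_measurable M" if "i \<in> I" for i
      using f[OF that] by (simp add: g_def[abs_def])
    have "AE x in M. f i x = g i x * \<alpha> i" if "i \<in> I" for i
    proof (cases "\<alpha> i = 0")
      case True
      then have "AE x in M. ennreal_rpow (f i x) r = 0"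
        using \<alpha>[of i] f[OF that] by (simp add: nn_integral_0_iff_AE)
      then show ?thesis
        by eventually_elim (simp add: True)
    next
      case False
      have "f i x = g i x * \<alpha> i" for x
        using False finite[OF that] ennreal_mult_divide_eq[of "\<alpha> i" "f i x"]
        by (simp add: g_def divide_ennreal_def mult_ac)
      then show ?thesis by simp
    qed
    then have "AE x in M. \<forall>i\<in>I. f i x = g i x * \<alpha> i"
      using I by (simp add: AE_ball_countable)
    then have "AE x in M. ennreal_rpow (\<integral>\<^sup>+i. f i x \<partial>count_space I) r
        \<le> (\<integral>\<^sup>+i. ennreal_rpow (g i x) r * \<alpha> i \<partial>count_space I) * ennreal_rpow A (r - 1)"
    proof eventually_elim
      case (elim x)
      then have "(\<integral>\<^sup>+i. f i x \<partial>count_space I) = (\<integral>\<^sup>+i. g i x * \<alpha> i \<partial>count_space I)"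
        by (intro nn_integral_cong) auto
      then show ?case
        unfolding A_def using 2(1) by (simp add: nn_integral_mult_rpow_le)
    qed
    then have "(\<integral>\<^sup>+x. ennreal_rpow (\<integral>\<^sup>+i. f i x \<partial>count_space I) r \<partial>M)
        \<le> (\<integral>\<^sup>+x. (\<integral>\<^sup>+i. ennreal_rpow (g i x) r * \<alpha> i \<partial>count_space I) * ennreal_rpow A (r - 1) \<partial>M)"
      by (rule nn_integral_mono_AE)
    also have "\<dots> = (\<integral>\<^sup>+i. \<integral>\<^sup>+x. ennreal_rpow (g i x) r * \<alpha> i \<partial>M \<partial>count_space I) * ennreal_rpow A (r - 1)"
    proof -
      have meas: "(\<lambda>x. ennreal_rpow (g i x) r * \<alpha> i) \<in> borel_measurable M" if "i \<in> I" for i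
        using g[OF that] by measurable
      have "(\<integral>\<^sup>+x. (\<integral>\<^sup>+i. ennreal_rpow (g i x) r * \<alpha> i \<partial>count_space I) * ennreal_rpow A (r - 1) \<partial>M)
          = (\<integral>\<^sup>+x. \<integral>\<^sup>+i. ennreal_rpow (g i x) r * \<alpha> i \<partial>count_space I \<partial>M) * ennreal_rpow A (r - 1)"
        using borel_measurable_nn_integral_count_space[OF I meas] by (rule nn_integral_multc)
      then show ?thesis
        using nn_integral_count_space_nn_integral[OF I meas] by simp
    qed
    also have "\<dots> \<le> A * ennreal_rpow A (r - 1)"
      unfolding A_def
    proof (intro mult_right_mono nn_integral_mono)
      fix i assume "i \<in> space (count_space I)"
      then have i: "i \<in> I" by simp
      have "(\<integral>\<^sup>+x. ennreal_rpow (g i x) r * \<alpha> i \<partial>M)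
          = (\<integral>\<^sup>+x. ennreal_rpow (f i x) r \<partial>M) * ennreal_rpow (inverse (\<alpha> i)) r * \<alpha> i"
        using f[OF i] by (simp add: g_def ennreal_rpow_mult nn_integral_multc)
      also have "\<dots> = ennreal_rpow (\<alpha> i * inverse (\<alpha> i)) r * \<alpha> i"
        by (simp add: \<alpha> ennreal_rpow_mult)
      \<comment> \<open>Equality holds unless \<open>\<alpha> i = 0\<close>, and then the trailing
        factor makes the left-hand side 0.\<close>
      also have "\<dots> \<le> \<alpha> i"
      proof (cases "\<alpha> i = 0")
        case False
        then have "\<alpha> i * inverse (\<alpha> i) = ennreal 1"
          using finite[OF i] by (simp add: less_top flip: divide_ennreal_def)
        then have "ennreal_rpow (\<alpha> i * inverse (\<alpha> i)) r = ennreal 1"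
          by (simp only: ennreal_rpow_ennreal[OF zero_le_one] powr_one_eq_one)
        then show ?thesis by simp
      qed simp
      finally show "(\<integral>\<^sup>+x. ennreal_rpow (g i x) r * \<alpha> i \<partial>M) \<le> \<alpha> i" .
    qed auto
    also have "\<dots> = ennreal_rpow A r"
      by (rule ennreal_mult_rpow_diff_1)
    finally show ?thesis .
  qed simp
  with 2(1) show ?thesis
    unfolding A_def \<alpha>_def 2(2) by (simp add: eLp_norm_le_iff)
qed

lemma eLp_norm_sum_le:
  assumes "1 \<le> p" "finite I" "\<And>i. i \<in> I \<Longrightarrow> f i \<in> borel_measurable M"
  shows "eLp_norm p M (\<lambda>x. \<Sum>i\<in>I. f i x) \<le> (\<Sum>i\<in>I. eLp_norm p M (f i))"
  using eLp_norm_nn_integral_count_space_le[of p I f M] assms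
  by (simp add: nn_integral_count_space_finite countable_finite)

lemma eLp_norm_add_le:
  assumes "1 \<le> p" "f \<in> borel_measurable M" "g \<in> borel_measurable M"
  shows "eLp_norm p M (\<lambda>x. f x + g x) \<le> eLp_norm p M f + eLp_norm p M g"
  using eLp_norm_sum_le[of p "UNIV :: bool set" "\<lambda>b. if b then f else g" M] assms
  by (simp add: UNIV_bool add.commute)

lemma eLp_norm_finite_AE:
  assumes "1 \<le> p" "f \<in> borel_measurable M" "eLp_norm p M f < \<infinity>"
  shows "AE x in M. f x < \<infinity>"
  using assms(1)
proof (cases rule: exponent_cases)
  case 1
  with assms(3) esssup_AE[of f M] show ?thesis
    by (auto elim!: eventually_mono)
next
  case (2 r)
  then have "(\<integral>\<^sup>+x. ennreal_rpow (f x) r \<partial>M) \<noteq> \<infinity>"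
    using assms(3) by (auto simp: eLp_norm_ennreal)
  then have "AE x in M. ennreal_rpow (f x) r \<noteq> \<infinity>"
    using assms(2) by (intro nn_integral_PInf_AE) auto
  then show ?thesis
    by eventually_elim (simp add: less_top)
qed

lemma eLp_norm_eq_0_AE:
  assumes "1 \<le> p" "f \<in> borel_measurable M" "eLp_norm p M f = 0"
  shows "AE x in M. f x = 0"
  using assms(1)
proof (cases rule: exponent_cases)
  case 1
  with assms(3) esssup_AE[of f M] show ?thesis
    by auto
next
  case (2 r)
  then have "(\<integral>\<^sup>+x. ennreal_rpow (f x) r \<partial>M) = 0"
    using assms(3) by (simp add: eLp_norm_ennreal)
  then have "AE x in M. ennreal_rpow (f x) r = 0"
    using assms(2) by (subst (asm) nn_integral_0_iff_AE) auto
  then show ?thesis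
    by simp
qed

text \<open>Lets the results on function norms apply to sequences. For p = \<infinity> the two
  suprema agree because the only null set of counting measure is empty.\<close>

lemma lp_norm_eq_eLp_norm:
  fixes s :: "'k :: countable \<Rightarrow> complex"
  assumes "1 \<le> p"
  shows "lp_norm p s = eLp_norm p (count_space UNIV) (\<lambda>k. ennreal (cmod (s k)))"
  using assms
proof (cases rule: exponent_cases)
  case 1
  have "(SUP k. ennreal (cmod (s k))) = esssup (count_space UNIV) (\<lambda>k. ennreal (cmod (s k)))"
  proof (intro antisym SUP_least esssup_I)
    fix k
    have "AE k in count_space UNIV. ennreal (cmod (s k)) \<le> esssup (count_space UNIV) (\<lambda>k. ennreal (cmod (s k)))"
      by (rule esssup_AE)
    then show "ennreal (cmod (s k)) \<le> esssup (count_space UNIV) (\<lambda>k. ennreal (cmod (s k)))"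
      by (simp add: AE_count_space)
  qed (auto simp: AE_count_space intro: SUP_upper)
  with 1 show ?thesis
    by (simp add: lp_norm_def)
next
  case (2 r)
  then show ?thesis
    by (simp add: lp_norm_def eLp_norm_def infsum_ennreal_eq_nn_integral)
qed

section \<open>Lattice sums\<close>

lemma int_vec_diff: "int_vec (k - m) = int_vec k - int_vec m"
  by (simp add: int_vec_def vec_eq_iff)

lemma nn_integral_int_vec_shift:
  fixes f :: "int ^ 'n \<Rightarrow> ennreal"
  shows "(\<integral>\<^sup>+k. f (k - m) \<partial>count_space UNIV) = (\<integral>\<^sup>+k. f k \<partial>count_space UNIV)"
    and "(\<integral>\<^sup>+k. f (m - k) \<partial>count_space UNIV) = (\<integral>\<^sup>+k. f k \<partial>count_space UNIV)"
proof -
  have "bij (\<lambda>k. k - m)"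
    by (rule bij_betw_byWitness[where f' = "\<lambda>k. k + m"]) auto
  then show "(\<integral>\<^sup>+k. f (k - m) \<partial>count_space UNIV) = (\<integral>\<^sup>+k. f k \<partial>count_space UNIV)"
    by (rule nn_integral_bij_count_space)
  have "bij (\<lambda>k. m - k)"
    by (rule bij_betw_byWitness[where f' = "\<lambda>k. m - k"]) auto
  then show "(\<integral>\<^sup>+k. f (m - k) \<partial>count_space UNIV) = (\<integral>\<^sup>+k. f k \<partial>count_space UNIV)"
    by (rule nn_integral_bij_count_space)
qed

lemma unit_cube_subset_cbox: "unit_cube \<subseteq> cbox 0 (1 :: real ^ 'n)"
  by (auto simp: unit_cube_def mem_box_cart less_imp_le)

lemma unit_cube_lmeasurable: "(unit_cube :: (real ^ 'n) set) \<in> lmeasurable"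
proof (rule measurable_convex)
  show "convex (unit_cube :: (real ^ 'n) set)"
  proof (rule convexI)
    fix x y :: "real ^ 'n" and u v :: real
    assume *: "x \<in> unit_cube" "y \<in> unit_cube" "0 \<le> u" "0 \<le> v" "u + v = 1"
    have "0 \<le> u * x $ i + v * y $ i \<and> u * x $ i + v * y $ i < 1" for i
    proof
      show "0 \<le> u * x $ i + v * y $ i"
        using * by (simp add: unit_cube_def)
      show "u * x $ i + v * y $ i < 1"
        using * by (intro convex_bound_lt) (auto simp: unit_cube_def)
    qed
    then show "u *\<^sub>R x + v *\<^sub>R y \<in> unit_cube"
      by (simp add: unit_cube_def)
  qed
  show "bounded (unit_cube :: (real ^ 'n) set)"
    by (rule bounded_subset[OF bounded_cbox unit_cube_subset_cbox])
qed

lemma nn_integral_lebesgue_translate: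
  fixes g :: "real ^ 'n \<Rightarrow> ennreal"
  assumes "g \<in> borel_measurable lebesgue"
  shows "(\<integral>\<^sup>+x. g (x + v) \<partial>lebesgue) = (\<integral>\<^sup>+x. g x \<partial>lebesgue)"
  using nn_integral_lebesgue_affine[of "mat 1 :: real^'n^'n" g v] assms by simp

lemma measurable_lebesgue_translate:
  fixes g :: "real ^ 'n \<Rightarrow> ennreal"
  assumes "g \<in> borel_measurable lebesgue"
  shows "(\<lambda>x. g (x + v)) \<in> borel_measurable lebesgue" "(\<lambda>x. g (x - v)) \<in> borel_measurable lebesgue"
  using measurable_compose[OF measurable_affine_lebesgue[of "mat 1 :: real^'n^'n" v] assms]
    measurable_compose[OF measurable_affine_lebesgue[of "mat 1 :: real^'n^'n" "- v"] assms]
  by simp_all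

section \<open>The lattice generated by b and its fundamental cell\<close>

locale lattice_matrix =
  fixes b :: "real ^ 'n ^ 'n"
  assumes det_b: "det b \<noteq> 0"
begin

abbreviation "cell \<equiv> (*v) b ` unit_cube"

text \<open>For w = |\<psi>| this is the function Q, that is, the periodization without its factor
  |det b|. The integral form makes Tonelli directly applicable.\<close>

definition lattice_sum :: "(real ^ 'n \<Rightarrow> ennreal) \<Rightarrow> real ^ 'n \<Rightarrow> ennreal" where
  "lattice_sum w x = (\<integral>\<^sup>+k. w (x - b *v int_vec k) \<partial>count_space UNIV)"

lemma cell_sets: "cell \<in> sets lebesgue"
  using measure_matrix_image(1)[OF unit_cube_lmeasurable] by (rule fmeasurableD)

text \<open>The only possible k is the coordinatewise floor of the inverse of b applied to x; the
  half-open cube excludes a second choice on the faces.\<close>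

lemma ex1_cell: "\<exists>!k. x - b *v int_vec k \<in> cell"
proof -
  obtain B where B: "\<And>x. b *v (B *v x) = x" "\<And>x. B *v (b *v x) = x"
    using matrix_inverse_exE[OF det_b] by metis
  have "x - b *v int_vec k \<in> cell \<longleftrightarrow> k = (\<chi> i. \<lfloor>(B *v x) $ i\<rfloor>)" for k
  proof -
    have "x - b *v int_vec k \<in> cell \<longleftrightarrow> B *v x - int_vec k \<in> unit_cube"
    proof
      assume "x - b *v int_vec k \<in> cell"
      then obtain u where u: "u \<in> unit_cube" "x - b *v int_vec k = b *v u"
        by blast
      from arg_cong[OF u(2), of "(*v) B"] u(1) show "B *v x - int_vec k \<in> unit_cube"
        by (simp add: B matrix_vector_mult_diff_distrib)
    next
      assume "B *v x - int_vec k \<in> unit_cube"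
      then show "x - b *v int_vec k \<in> cell"
        by (rule rev_image_eqI) (simp add: B matrix_vector_mult_diff_distrib)
    qed
    also have "\<dots> \<longleftrightarrow> (\<forall>i. \<lfloor>(B *v x) $ i\<rfloor> = k $ i)"
    proof -
      have "\<lfloor>(B *v x) $ i\<rfloor> = k $ i \<longleftrightarrow>
          0 \<le> (B *v x) $ i - real_of_int (k $ i) \<and> (B *v x) $ i - real_of_int (k $ i) < 1" for i
        by (auto simp: floor_eq_iff)
      then show ?thesis
        by (simp add: unit_cube_def int_vec_def)
    qed
    finally show ?thesis
      by (auto simp: vec_eq_iff)
  qed
  then show ?thesis
    by simp
qed

lemma nn_integral_indicator_cell:
  "(\<integral>\<^sup>+k. indicator cell (x - b *v int_vec k) \<partial>count_space UNIV) = (1 :: ennreal)"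
proof -
  obtain k0 where "\<And>k. x - b *v int_vec k \<in> cell \<longleftrightarrow> k = k0"
    using ex1_cell[of x] by blast
  then show ?thesis
    by (subst nn_integral_count_space'[of "{k0}"]) (auto simp: indicator_def)
qed

lemma lattice_sum_measurable:
  "w \<in> borel_measurable lebesgue \<Longrightarrow> lattice_sum w \<in> borel_measurable lebesgue"
  unfolding lattice_sum_def[abs_def]
  by (intro borel_measurable_nn_integral_count_space measurable_lebesgue_translate) auto

lemma lattice_sum_periodic: "lattice_sum w (x + b *v int_vec m) = lattice_sum w x"
proof -
  have "x + b *v int_vec m - b *v int_vec k = x - b *v int_vec (k - m)" for k
    by (simp add: int_vec_diff matrix_vector_mult_diff_distrib)
  then show ?thesis
    using nn_integral_int_vec_shift(1)[of "\<lambda>k. w (x - b *v int_vec k)" m]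
    by (simp only: lattice_sum_def)
qed

text \<open>The lattice is symmetric under k -> -k. Folding an integral to the cell produces sums
  with a plus sign, which this identifies with Q.\<close>

lemma lattice_sum_eq_plus: "lattice_sum w x = (\<integral>\<^sup>+k. w (x + b *v int_vec k) \<partial>count_space UNIV)"
proof -
  have "x - b *v int_vec (0 - k) = x + b *v int_vec k" for k
    unfolding int_vec_diff matrix_vector_mult_diff_distrib
    by (simp add: int_vec_def zero_vec_def[symmetric])
  then show ?thesis
    using nn_integral_int_vec_shift(2)[of "\<lambda>k. w (x - b *v int_vec k)" 0]
    by (simp only: lattice_sum_def)
qed

text \<open>The indicators of the translated cells form a partition of unity. Insert it, exchange
  sum and integral, move each piece back to the cell by translation invariance, and exchange
  again.\<close>

lemma nn_integral_eq_cell: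
  assumes g: "g \<in> borel_measurable lebesgue"
  shows "(\<integral>\<^sup>+x. g x \<partial>lebesgue)
    = (\<integral>\<^sup>+x. (\<integral>\<^sup>+k. g (x + b *v int_vec k) \<partial>count_space UNIV) * indicator cell x \<partial>lebesgue)"
proof -
  have ind: "indicator cell \<in> borel_measurable lebesgue"
    using cell_sets by simp
  note meas = borel_measurable_times_ennreal[OF g measurable_lebesgue_translate(2)[OF ind]]
    borel_measurable_times_ennreal[OF measurable_lebesgue_translate(1)[OF g] ind]
  have "(\<integral>\<^sup>+x. g x \<partial>lebesgue)
      = (\<integral>\<^sup>+x. \<integral>\<^sup>+k. g x * indicator cell (x - b *v int_vec k) \<partial>count_space UNIV \<partial>lebesgue)"
    by (simp add: nn_integral_cmult nn_integral_indicator_cell)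
  also have "\<dots> = (\<integral>\<^sup>+k. \<integral>\<^sup>+x. g x * indicator cell (x - b *v int_vec k) \<partial>lebesgue \<partial>count_space UNIV)"
    by (rule nn_integral_count_space_nn_integral) (auto intro: meas)
  also have "\<dots> = (\<integral>\<^sup>+k. \<integral>\<^sup>+x. g (x + b *v int_vec k) * indicator cell x \<partial>lebesgue \<partial>count_space UNIV)"
  proof (rule nn_integral_cong)
    fix k
    show "(\<integral>\<^sup>+x. g x * indicator cell (x - b *v int_vec k) \<partial>lebesgue)
        = (\<integral>\<^sup>+x. g (x + b *v int_vec k) * indicator cell x \<partial>lebesgue)"
      using nn_integral_lebesgue_translate[OF meas(1)[of "b *v int_vec k"], of "b *v int_vec k"] by simp
  qed
  also have "\<dots> = (\<integral>\<^sup>+x. \<integral>\<^sup>+k. g (x + b *v int_vec k) * indicator cell x \<partial>count_space UNIV \<partial>lebesgue)"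
    by (rule nn_integral_count_space_nn_integral[symmetric]) (auto intro: meas)
  also have "\<dots> = (\<integral>\<^sup>+x. (\<integral>\<^sup>+k. g (x + b *v int_vec k) \<partial>count_space UNIV) * indicator cell x \<partial>lebesgue)"
    by (simp add: nn_integral_multc)
  finally show ?thesis .
qed

text \<open>Every point has a lattice translate in the cell, and the countably many translates of
  the exceptional null set together are still null. The second assumption carries \<open>P\<close>
  from the translate back to the point.\<close>

lemma AE_lebesgue_if_AE_cell:
  assumes "AE x in lebesgue_on cell. P x" and "\<And>x k. P (x - b *v int_vec k) \<Longrightarrow> P x"
  shows "AE x in lebesgue. P x"
proof -
  have cell: "AE x in lebesgue. x \<in> cell \<longrightarrow> P x"
    using assms(1) cell_sets by (simp add: AE_restrict_space_iff)
  have "AE x in lebesgue. x - b *v int_vec k \<in> cell \<longrightarrow> P (x - b *v int_vec k)" for k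
    using AE_lebesgue_affine[OF _ cell, of "mat 1" "- (b *v int_vec k)"] by simp
  then have "AE x in lebesgue. \<forall>k. x - b *v int_vec k \<in> cell \<longrightarrow> P (x - b *v int_vec k)"
    by (simp add: AE_all_countable)
  then show ?thesis
  proof eventually_elim
    case (elim x)
    then show ?case
      using ex1_cell[of x] assms(2) by blast
  qed
qed

text \<open>A Young-type inequality for the convolution of a sequence on the lattice with a function
  on the space, where the L^1 norm of Young's inequality is replaced by the norm of Q over one
  cell.\<close>

lemma eLp_norm_lattice_convolution_le:
  fixes c :: "int ^ 'n \<Rightarrow> ennreal"
  assumes p: "1 \<le> p" and w: "w \<in> borel_measurable lebesgue"
  shows "eLp_norm p lebesgue (\<lambda>x. \<integral>\<^sup>+k. c k * w (x - b *v int_vec k) \<partial>count_space UNIV)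
    \<le> eLp_norm p (count_space UNIV) c * eLp_norm p (lebesgue_on cell) (lattice_sum w)"
proof -
  have wk: "(\<lambda>x. w (x - b *v int_vec k)) \<in> borel_measurable lebesgue" for k
    using w by (rule measurable_lebesgue_translate)
  have meas: "(\<lambda>x. \<integral>\<^sup>+k. c k * w (x - b *v int_vec k) \<partial>count_space UNIV) \<in> borel_measurable lebesgue"
    by (rule borel_measurable_nn_integral_count_space) (auto intro!: borel_measurable_times_ennreal wk)
  show ?thesis
    using p
  proof (cases rule: exponent_cases)
    case 1
    have "AE x in lebesgue. lattice_sum w x \<le> esssup (lebesgue_on cell) (lattice_sum w)"
    proof (rule AE_lebesgue_if_AE_cell[OF esssup_AE])
      fix x k
      show "lattice_sum w (x - b *v int_vec k) \<le> e \<Longrightarrow> lattice_sum w x \<le> e" for e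
        using lattice_sum_periodic[of w "x - b *v int_vec k" k] by simp
    qed
    then have "AE x in lebesgue. (\<integral>\<^sup>+k. c k * w (x - b *v int_vec k) \<partial>count_space UNIV)
        \<le> esssup (count_space UNIV) c * esssup (lebesgue_on cell) (lattice_sum w)"
    proof eventually_elim
      case (elim x)
      have "c k \<le> esssup (count_space UNIV) c" for k
        using esssup_AE[of c "count_space UNIV"] by (simp add: AE_count_space)
      then have "(\<integral>\<^sup>+k. c k * w (x - b *v int_vec k) \<partial>count_space UNIV)
          \<le> (\<integral>\<^sup>+k. esssup (count_space UNIV) c * w (x - b *v int_vec k) \<partial>count_space UNIV)"
        by (intro nn_integral_mono mult_right_mono) auto
      also have "\<dots> = esssup (count_space UNIV) c * lattice_sum w x"
        by (simp add: nn_integral_cmult lattice_sum_def)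
      also have "\<dots> \<le> esssup (count_space UNIV) c * esssup (lebesgue_on cell) (lattice_sum w)"
        using elim by (rule mult_left_mono) simp
      finally show ?case .
    qed
    with 1 meas show ?thesis
      by auto
  next
    case (2 r)
    let ?Q = "lattice_sum w"
    have Q [measurable]: "?Q \<in> borel_measurable lebesgue"
      using w by (rule lattice_sum_measurable)
    define R where "R x = ennreal_rpow (?Q x) (r - 1)" for x
    have R [measurable]: "R \<in> borel_measurable lebesgue"
      unfolding R_def[abs_def] by measurable
    have R_periodic: "R (x + b *v int_vec k) = R x" for x k
      by (simp add: R_def lattice_sum_periodic)
    have wR: "(\<lambda>x. w x * R x) \<in> borel_measurable lebesgue"
      using w by measurable
    \<comment> \<open>The value does not depend on k: a shift by bk leaves R unchanged. After
      folding, the sum of w over the lattice gives one factor Q, which R completes to the r-th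
      power.\<close>
    have cell_integral: "(\<integral>\<^sup>+x. w (x - b *v int_vec k) * R x \<partial>lebesgue)
        = (\<integral>\<^sup>+x. ennreal_rpow (?Q x) r \<partial>lebesgue_on cell)" for k
    proof -
      have "(\<integral>\<^sup>+x. w (x - b *v int_vec k) * R x \<partial>lebesgue) = (\<integral>\<^sup>+x. w x * R x \<partial>lebesgue)"
        using nn_integral_lebesgue_translate[of "\<lambda>x. w (x - b *v int_vec k) * R x" "b *v int_vec k"] wk[of k]
        by (simp add: R_periodic)
      also have "\<dots> = (\<integral>\<^sup>+x. (\<integral>\<^sup>+k. w (x + b *v int_vec k) * R x \<partial>count_space UNIV) * indicator cell x \<partial>lebesgue)"
        unfolding nn_integral_eq_cell[OF wR] R_periodic ..
      also have "\<dots> = (\<integral>\<^sup>+x. ennreal_rpow (?Q x) r * indicator cell x \<partial>lebesgue)"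
        by (simp add: nn_integral_multc R_def ennreal_mult_rpow_diff_1 flip: lattice_sum_eq_plus)
      also have "\<dots> = (\<integral>\<^sup>+x. ennreal_rpow (?Q x) r \<partial>lebesgue_on cell)"
        using cell_sets by (simp add: nn_integral_restrict_space)
      finally show ?thesis .
    qed
    have "(\<integral>\<^sup>+x. ennreal_rpow (\<integral>\<^sup>+k. c k * w (x - b *v int_vec k) \<partial>count_space UNIV) r \<partial>lebesgue)
        \<le> (\<integral>\<^sup>+x. (\<integral>\<^sup>+k. ennreal_rpow (c k) r * w (x - b *v int_vec k) \<partial>count_space UNIV) * R x \<partial>lebesgue)"
      unfolding R_def lattice_sum_def
      using 2(1) by (intro nn_integral_mono nn_integral_mult_rpow_le) auto
    also have "\<dots> = (\<integral>\<^sup>+x. \<integral>\<^sup>+k. ennreal_rpow (c k) r * (w (x - b *v int_vec k) * R x) \<partial>count_space UNIV \<partial>lebesgue)"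
      by (simp add: mult.assoc flip: nn_integral_multc)
    also have "\<dots> = (\<integral>\<^sup>+k. \<integral>\<^sup>+x. ennreal_rpow (c k) r * (w (x - b *v int_vec k) * R x) \<partial>lebesgue \<partial>count_space UNIV)"
      by (intro nn_integral_count_space_nn_integral borel_measurable_times_ennreal
          borel_measurable_const wk R) simp
    also have "\<dots> = (\<integral>\<^sup>+k. ennreal_rpow (c k) r * (\<integral>\<^sup>+x. ennreal_rpow (?Q x) r \<partial>lebesgue_on cell) \<partial>count_space UNIV)"
      using wk by (intro nn_integral_cong) (simp add: nn_integral_cmult cell_integral)
    also have "\<dots> = (\<integral>\<^sup>+k. ennreal_rpow (c k) r \<partial>count_space UNIV) * (\<integral>\<^sup>+x. ennreal_rpow (?Q x) r \<partial>lebesgue_on cell)"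
      by (simp add: nn_integral_multc)
    finally show ?thesis
      unfolding 2(2) using 2(1)
      by (subst eLp_norm_le_iff) (simp_all add: ennreal_rpow_mult eLp_norm_rpow)
  qed
qed

text \<open>Undoing the normalization of the periodization is what puts the inverse of |det b| into
  the operator bound.\<close>

lemma eLp_norm_lattice_sum_le:
  assumes "1 \<le> p" "periodization b w \<in> borel_measurable lebesgue"
  shows "eLp_norm p (lebesgue_on cell) (lattice_sum w)
    \<le> ennreal (inverse \<bar>det b\<bar>) * eLp_norm p (lebesgue_on cell) (periodization b w)"
proof -
  have "ennreal (inverse \<bar>det b\<bar>) * ennreal \<bar>det b\<bar> = ennreal 1"
    using det_b by (simp flip: ennreal_mult)
  then have "lattice_sum w = (\<lambda>x. ennreal (inverse \<bar>det b\<bar>) * periodization b w x)"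
    by (simp add: fun_eq_iff periodization_def lattice_sum_def infsum_ennreal_eq_nn_integral
        flip: mult.assoc)
  then show ?thesis
    using eLp_norm_cmult_le[OF assms(1) measurable_restrict_space1[OF assms(2)]] by simp
qed

text \<open>Local integrability controls compact sets, and the half-open cell is not compact; it
  lies in the image of the closed cube, which is.\<close>

lemma eLp_norm_periodization_cell_finite:
  assumes p: "1 \<le> p" and g: "periodization b w \<in> eLp_loc p"
  shows "eLp_norm p (lebesgue_on cell) (periodization b w) < \<infinity>"
proof -
  let ?g = "periodization b w" and ?K = "(*v) b ` cbox 0 1"
  have [measurable]: "?g \<in> borel_measurable lebesgue"
    using g by (simp add: eLp_loc_def)
  have K: "compact ?K"
    by (intro compact_continuous_image linear_continuous_on matrix_vector_mul_bounded_linear compact_cbox)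
  then have K_sets: "?K \<in> sets lebesgue"
    by (intro fmeasurableD lmeasurable_compact)
  have sub: "cell \<subseteq> ?K"
    using unit_cube_subset_cbox by blast
  have "eLp_norm p (lebesgue_on cell) ?g \<le> eLp_norm p (lebesgue_on ?K) ?g"
    using p
  proof (cases rule: exponent_cases)
    case 1
    have "AE x in lebesgue. x \<in> ?K \<longrightarrow> ?g x \<le> esssup (lebesgue_on ?K) ?g"
      using esssup_AE[of ?g "lebesgue_on ?K"] K_sets by (simp add: AE_restrict_space_iff)
    then have "AE x in lebesgue_on cell. ?g x \<le> esssup (lebesgue_on ?K) ?g"
      using cell_sets sub by (auto simp: AE_restrict_space_iff elim!: eventually_mono)
    with 1 show ?thesis
      by (auto intro!: measurable_restrict_space1)
  next
    case (2 r)
    have "(\<integral>\<^sup>+x. ennreal_rpow (?g x) r \<partial>lebesgue_on cell) \<le> (\<integral>\<^sup>+x. ennreal_rpow (?g x) r \<partial>lebesgue_on ?K)"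
      using cell_sets K_sets sub
      by (subst (1 2) nn_integral_restrict_space)
        (auto intro!: nn_integral_mono mult_left_mono indicator_leI)
    with 2(1) show ?thesis
      by (simp add: 2(2) eLp_norm_ennreal ennreal_rpow_mono)
  qed
  also have "\<dots> < \<infinity>"
    using g K by (simp add: eLp_loc_def)
  finally show ?thesis .
qed

end

text \<open>The r-th power of the normalizing factor is |det A|, which cancels the Jacobian factor
  of the substitution y = Ax.\<close>

lemma eLp_norm_dilation_le:
  fixes A :: "real ^ 'n ^ 'n"
  assumes p: "1 \<le> p" and A: "det A \<noteq> 0" and g: "g \<in> borel_measurable lebesgue"
  shows "eLp_norm p lebesgue (\<lambda>x. ennreal (\<bar>det A\<bar> powr recip_exp p) * g (A *v x)) \<le> eLp_norm p lebesgue g"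
proof -
  have gA: "(\<lambda>x. g (A *v x)) \<in> borel_measurable lebesgue"
    using measurable_compose[OF measurable_affine_lebesgue[OF A, of 0] g] by simp
  show ?thesis
    using p
  proof (cases rule: exponent_cases)
    case 1
    have "AE x in lebesgue. g (A *v x) \<le> esssup lebesgue g"
      using AE_lebesgue_affine[OF A esssup_AE, of g 0] by simp
    \<comment> \<open>Here \<open>recip_exp p = 0\<close>, and the normalizing factor is 1 because
      \<open>det A\<close> is nonzero.\<close>
    with 1 gA A show ?thesis
      by (auto simp: recip_exp_def)
  next
    case (2 r)
    have "(\<integral>\<^sup>+x. ennreal_rpow (ennreal (\<bar>det A\<bar> powr (1 / r)) * g (A *v x)) r \<partial>lebesgue)
        = ennreal \<bar>det A\<bar> * (\<integral>\<^sup>+x. ennreal_rpow (g (A *v x)) r \<partial>lebesgue)"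
      using gA 2(1) by (simp add: ennreal_rpow_mult nn_integral_cmult powr_powr)
    also have "\<dots> = ennreal \<bar>det A\<bar> * (ennreal (inverse \<bar>det A\<bar>) * (\<integral>\<^sup>+x. ennreal_rpow (g x) r \<partial>lebesgue))"
      using nn_integral_lebesgue_affine[OF A, of "\<lambda>x. ennreal_rpow (g x) r" 0] g by simp
    also have "\<dots> = (\<integral>\<^sup>+x. ennreal_rpow (g x) r \<partial>lebesgue)"
      using A by (simp flip: ennreal_mult mult.assoc)
    finally show ?thesis
      using 2(1) unfolding 2(3) unfolding 2(2) by (simp add: eLp_norm_ennreal)
  qed
qed

section \<open>Absolutely convergent series in $L^p$ and the synthesis operator\<close>

lemma Lp_space_iff: "f \<in> Lp_space p M \<longleftrightarrow> f \<in> borel_measurable M \<and> Lp_norm p M f < \<infinity>"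
  by (simp add: Lp_space_def)

lemma nn_integral_tail_tendsto_0:
  fixes \<alpha> :: "nat \<Rightarrow> ennreal"
  assumes "(\<integral>\<^sup>+j. \<alpha> j \<partial>count_space {m<..}) < \<infinity>"
  shows "(\<lambda>N. \<integral>\<^sup>+j. \<alpha> j \<partial>count_space {N<..}) \<longlonglongrightarrow> 0"
proof -
  \<comment> \<open>The maximum keeps every tail inside \<open>{m<..}\<close>, where the assumption
    supplies an integrable majorant; from N = m on it equals N.\<close>
  have "(\<lambda>N. \<integral>\<^sup>+j. \<alpha> j * indicator {max m N<..} j \<partial>count_space UNIV)
      \<longlonglongrightarrow> (\<integral>\<^sup>+j. 0 \<partial>count_space (UNIV :: nat set))"
  proof (rule nn_integral_dominated_convergence[where w = "\<lambda>j. \<alpha> j * indicator {m<..} j"])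
    show "AE j in count_space UNIV. (\<lambda>N. \<alpha> j * indicator {max m N<..} j) \<longlonglongrightarrow> 0"
    proof (rule AE_I2)
      fix j
      have "\<forall>\<^sub>F N in sequentially. \<alpha> j * indicator {max m N<..} j = 0"
        using eventually_ge_at_top[of j] by eventually_elim simp
      then show "(\<lambda>N. \<alpha> j * indicator {max m N<..} j) \<longlonglongrightarrow> 0"
        by (rule tendsto_eventually)
    qed
    show "(\<integral>\<^sup>+j. \<alpha> j * indicator {m<..} j \<partial>count_space UNIV) < \<infinity>"
      using assms by (simp add: nn_integral_count_space_indicator)
  qed (auto simp: indicator_def)
  then have lim: "(\<lambda>N. \<integral>\<^sup>+j. \<alpha> j \<partial>count_space {max m N<..}) \<longlonglongrightarrow> 0"
    by (simp add: nn_integral_count_space_indicator)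
  have "\<forall>\<^sub>F N in sequentially. max m N = N"
    using eventually_ge_at_top[of m] by eventually_elim simp
  then have "\<forall>\<^sub>F N in sequentially.
      (\<integral>\<^sup>+j. \<alpha> j \<partial>count_space {max m N<..}) = (\<integral>\<^sup>+j. \<alpha> j \<partial>count_space {N<..})"
    by eventually_elim simp
  then show ?thesis
    using lim by (simp cong: filterlim_cong add: tendsto_cong)
qed

text \<open>The Riesz-Fischer argument with an explicit limit, the pointwise sum: Minkowski bounds
  the norm of the sum of the moduli, which is therefore finite almost everywhere.\<close>

lemma Lp_abs_sums_infsum:
  fixes f :: "nat \<Rightarrow> 'a \<Rightarrow> complex"
  assumes p: "1 \<le> p" and f: "\<And>j. 0 < j \<Longrightarrow> f j \<in> Lp_space p M"
    and fin: "(\<Sum>\<^sub>\<infinity>j\<in>{0<..}. Lp_norm p M (f j)) < \<infinity>"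
  shows "AE x in M. (\<lambda>j. cmod (f j x)) summable_on {0<..}"
    and "Lp_abs_sums p M f (\<lambda>x. \<Sum>\<^sub>\<infinity>j\<in>{0<..}. f j x)"
    and "Lp_norm p M (\<lambda>x. \<Sum>\<^sub>\<infinity>j\<in>{0<..}. f j x) \<le> (\<Sum>\<^sub>\<infinity>j\<in>{0<..}. Lp_norm p M (f j))"
proof -
  define \<alpha> where "\<alpha> j = Lp_norm p M (f j)" for j
  \<comment> \<open>\<open>G 0\<close> gives pointwise summability and bounds the modulus of the
    limit; \<open>G N\<close> bounds the remainder after N terms.\<close>
  define G where "G N x = (\<integral>\<^sup>+j. ennreal (cmod (f j x)) \<partial>count_space {N<..})" for N x
  define F where "F x = (\<Sum>\<^sub>\<infinity>j\<in>{0<..}. f j x)" for x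
  have fm [measurable]: "f j \<in> borel_measurable M" if "0 < j" for j
    using f[OF that] by (simp add: Lp_space_def)
  have fm': "(\<lambda>x. ennreal (cmod (f j x))) \<in> borel_measurable M" if "j \<in> {N<..}" for j N
    using fm[of j] that by simp
  have Gm: "G N \<in> borel_measurable M" for N
    unfolding G_def[abs_def] using fm' by (intro borel_measurable_nn_integral_count_space) auto
  have Fm [measurable]: "F \<in> borel_measurable M"
    unfolding F_def[abs_def] by (intro borel_measurable_infsum_complex) auto
  have G_norm: "eLp_norm p M (G N) \<le> (\<integral>\<^sup>+j. \<alpha> j \<partial>count_space {N<..})" for N
    unfolding G_def[abs_def] \<alpha>_def Lp_norm_def
    by (intro eLp_norm_nn_integral_count_space_le p fm') auto
  have \<alpha>: "(\<Sum>\<^sub>\<infinity>j\<in>{0<..}. Lp_norm p M (f j)) = (\<integral>\<^sup>+j. \<alpha> j \<partial>count_space {0<..})"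
    by (simp add: infsum_ennreal_eq_nn_integral \<alpha>_def)
  with fin have \<alpha>_fin: "(\<integral>\<^sup>+j. \<alpha> j \<partial>count_space {0<..}) < \<infinity>"
    by simp
  then have "AE x in M. G 0 x < \<infinity>"
    by (intro eLp_norm_finite_AE[OF p Gm] le_less_trans[OF G_norm])
  then show summable: "AE x in M. (\<lambda>j. cmod (f j x)) summable_on {0<..}"
    unfolding G_def summable_norm_iff_nn_integral .
  have "eLp_norm p M (\<lambda>x. ennreal (cmod (F x))) \<le> eLp_norm p M (G 0)"
    unfolding F_def G_def by (intro eLp_norm_mono_AE p AE_I2 norm_infsum_le_nn_integral)
      (use Fm in \<open>simp add: F_def[abs_def]\<close>)
  with G_norm[of 0] have norm_F: "Lp_norm p M F \<le> (\<integral>\<^sup>+j. \<alpha> j \<partial>count_space {0<..})"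
    by (simp add: Lp_norm_def)
  then show "Lp_norm p M (\<lambda>x. \<Sum>\<^sub>\<infinity>j\<in>{0<..}. f j x) \<le> (\<Sum>\<^sub>\<infinity>j\<in>{0<..}. Lp_norm p M (f j))"
    unfolding \<alpha> F_def[abs_def] .
  have "Lp_norm p M (\<lambda>x. F x - (\<Sum>j=1..N. f j x)) \<le> (\<integral>\<^sup>+j. \<alpha> j \<partial>count_space {N<..})" for N
  proof -
    have "AE x in M. ennreal (cmod (F x - (\<Sum>j=1..N. f j x))) \<le> G N x"
      using summable
    proof eventually_elim
      case (elim x)
      then have s: "(\<lambda>j. f j x) summable_on {0<..}"
        by (rule abs_summable_summable)
      have split: "{0<..} = {1..N} \<union> {N<..}"
        by auto
      have "F x = (\<Sum>j=1..N. f j x) + (\<Sum>\<^sub>\<infinity>j\<in>{N<..}. f j x)"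
        unfolding F_def split
        by (subst infsum_Un_disjoint) (auto intro: summable_on_subset_banach[OF s])
      then show ?case
        unfolding G_def using norm_infsum_le_nn_integral[of "\<lambda>j. f j x" "{N<..}"] by simp
    qed
    moreover have "(\<lambda>x. F x - (\<Sum>j=1..N. f j x)) \<in> borel_measurable M"
      by (intro borel_measurable_diff borel_measurable_sum Fm fm) simp
    ultimately have "Lp_norm p M (\<lambda>x. F x - (\<Sum>j=1..N. f j x)) \<le> eLp_norm p M (G N)"
      unfolding Lp_norm_def by (intro eLp_norm_mono_AE[OF p]) simp_all
    with G_norm[of N] show ?thesis
      by (rule order.trans[rotated])
  qed
  then have "(\<lambda>N. Lp_norm p M (\<lambda>x. F x - (\<Sum>j=1..N. f j x))) \<longlonglongrightarrow> 0"
    by (intro tendsto_sandwich[OF _ _ tendsto_const nn_integral_tail_tendsto_0[OF \<alpha>_fin]]) auto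
  then show "Lp_abs_sums p M f (\<lambda>x. \<Sum>\<^sub>\<infinity>j\<in>{0<..}. f j x)"
    using f fin norm_F \<alpha>_fin Fm by (auto simp: Lp_abs_sums_def Lp_space_iff F_def[abs_def])
qed

text \<open>Two limits are compared through their common partial sums. This is what makes the choice
  of a representative in \<open>synthesis\<close> harmless.\<close>

lemma Lp_abs_sums_unique:
  assumes p: "1 \<le> p" and F: "Lp_abs_sums p M f F" and G: "Lp_abs_sums p M f G"
  shows "AE x in M. F x = G x"
proof -
  have [measurable]: "F \<in> borel_measurable M" "G \<in> borel_measurable M"
    and fm [measurable]: "\<And>j. 0 < j \<Longrightarrow> f j \<in> borel_measurable M"
    using F G by (auto simp: Lp_abs_sums_def Lp_space_iff)
  let ?S = "\<lambda>N x. \<Sum>j=1..N. f j x"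
  have Sm [measurable]: "?S N \<in> borel_measurable M" for N
    by (intro borel_measurable_sum fm) simp
  have "Lp_norm p M (\<lambda>x. F x - G x)
      \<le> Lp_norm p M (\<lambda>x. F x - ?S N x) + Lp_norm p M (\<lambda>x. G x - ?S N x)" for N
  proof -
    have "ennreal (cmod (F x - G x)) \<le> ennreal (cmod (F x - ?S N x)) + ennreal (cmod (G x - ?S N x))" for x
      using norm_triangle_ineq4[of "F x - ?S N x" "G x - ?S N x"]
      by (simp flip: ennreal_plus)
    then have "Lp_norm p M (\<lambda>x. F x - G x)
        \<le> eLp_norm p M (\<lambda>x. ennreal (cmod (F x - ?S N x)) + ennreal (cmod (G x - ?S N x)))"
      unfolding Lp_norm_def by (intro eLp_norm_mono_AE[OF p]) simp_all
    also have "\<dots> \<le> Lp_norm p M (\<lambda>x. F x - ?S N x) + Lp_norm p M (\<lambda>x. G x - ?S N x)"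
      unfolding Lp_norm_def by (intro eLp_norm_add_le[OF p]) simp_all
    finally show ?thesis .
  qed
  moreover have "(\<lambda>N. Lp_norm p M (\<lambda>x. F x - ?S N x) + Lp_norm p M (\<lambda>x. G x - ?S N x)) \<longlonglongrightarrow> 0 + 0"
    using F G by (intro tendsto_add) (auto simp: Lp_abs_sums_def)
  ultimately have "Lp_norm p M (\<lambda>x. F x - G x) \<le> 0 + 0"
    by (intro LIMSEQ_le_const[where X = "\<lambda>N. Lp_norm p M (\<lambda>x. F x - ?S N x) + Lp_norm p M (\<lambda>x. G x - ?S N x)"]) auto
  then have "eLp_norm p M (\<lambda>x. ennreal (cmod (F x - G x))) = 0"
    by (simp add: Lp_norm_def)
  then have "AE x in M. ennreal (cmod (F x - G x)) = 0"
    by (intro eLp_norm_eq_0_AE[OF p]) simp_all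
  then show ?thesis
    by eventually_elim simp
qed

section \<open>The mixed-norm sequence space\<close>

lemma l1lp_norm_eq_nn_integral: "l1lp_norm p c = (\<integral>\<^sup>+j. lp_norm p (c j) \<partial>count_space {0<..})"
  by (simp add: l1lp_norm_def infsum_ennreal_eq_nn_integral)

lemma lp_norm_le_l1lp_norm:
  assumes "0 < j"
  shows "lp_norm p (c j) \<le> l1lp_norm p c"
proof -
  have "lp_norm p (c j) = (\<integral>\<^sup>+i. lp_norm p (c i) * indicator {j} i \<partial>count_space {0<..})"
    using assms by (subst nn_integral_count_space'[of "{j}"]) (auto simp: indicator_def)
  also have "\<dots> \<le> l1lp_norm p c"
    unfolding l1lp_norm_eq_nn_integral by (intro nn_integral_mono) (auto simp: indicator_def)
  finally show ?thesis .
qed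

lemma l1lp_space_add:
  fixes c c' :: "nat \<Rightarrow> 'k :: countable \<Rightarrow> complex"
  assumes p: "1 \<le> p" and "c \<in> l1lp_space p" "c' \<in> l1lp_space p"
  shows "(\<lambda>j k. c j k + c' j k) \<in> l1lp_space p"
proof -
  have "lp_norm p (\<lambda>k. c j k + c' j k) \<le> lp_norm p (c j) + lp_norm p (c' j)" for j
  proof -
    have "eLp_norm p (count_space UNIV) (\<lambda>k. ennreal (cmod (c j k + c' j k)))
        \<le> eLp_norm p (count_space UNIV) (\<lambda>k. ennreal (cmod (c j k)) + ennreal (cmod (c' j k)))"
      by (intro eLp_norm_mono_AE p AE_I2) (auto simp: norm_triangle_ineq simp flip: ennreal_plus)
    also have "\<dots> \<le> lp_norm p (c j) + lp_norm p (c' j)"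
      unfolding lp_norm_eq_eLp_norm[OF p] by (intro eLp_norm_add_le p) auto
    finally show ?thesis
      by (simp add: lp_norm_eq_eLp_norm[OF p])
  qed
  then have "l1lp_norm p (\<lambda>j k. c j k + c' j k)
      \<le> (\<integral>\<^sup>+j. lp_norm p (c j) + lp_norm p (c' j) \<partial>count_space {0<..})"
    unfolding l1lp_norm_eq_nn_integral by (intro nn_integral_mono)
  also have "\<dots> = l1lp_norm p c + l1lp_norm p c'"
    unfolding l1lp_norm_eq_nn_integral by (intro nn_integral_add) auto
  finally show ?thesis
    using assms(2,3) by (auto simp: l1lp_space_def less_top[symmetric] top_unique)
qed

lemma l1lp_space_cmult:
  fixes c :: "nat \<Rightarrow> 'k :: countable \<Rightarrow> complex"
  assumes p: "1 \<le> p" and "c \<in> l1lp_space p"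
  shows "(\<lambda>j k. z * c j k) \<in> l1lp_space p"
proof -
  have "lp_norm p (\<lambda>k. z * c j k) \<le> ennreal (cmod z) * lp_norm p (c j)" for j
    unfolding lp_norm_eq_eLp_norm[OF p] norm_mult
    using eLp_norm_cmult_le[OF p, of "\<lambda>k. ennreal (cmod (c j k))" "count_space UNIV" "ennreal (cmod z)"]
    by (simp add: ennreal_mult)
  then have "l1lp_norm p (\<lambda>j k. z * c j k)
      \<le> (\<integral>\<^sup>+j. ennreal (cmod z) * lp_norm p (c j) \<partial>count_space {0<..})"
    unfolding l1lp_norm_eq_nn_integral by (intro nn_integral_mono)
  also have "\<dots> = ennreal (cmod z) * l1lp_norm p c"
    unfolding l1lp_norm_eq_nn_integral by (intro nn_integral_cmult) auto
  finally show ?thesis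
    using assms(2) by (auto simp: l1lp_space_def less_top[symmetric] top_unique ennreal_mult_eq_top_iff)
qed

section \<open>The synthesis operator\<close>

locale synthesis_setting = lattice_matrix b for b :: "real ^ 'n ^ 'n" +
  fixes a :: "nat \<Rightarrow> real ^ 'n ^ 'n"
    and \<psi> :: "real ^ 'n \<Rightarrow> complex"
    and p :: ennreal
  assumes det_a: "0 < j \<Longrightarrow> det (a j) \<noteq> 0"
    and p: "1 \<le> p"
    and \<psi>: "\<psi> \<in> borel_measurable lebesgue"
    and periodization_loc: "periodization b (\<lambda>x. ennreal (cmod (\<psi> x))) \<in> eLp_loc p"
begin

abbreviation "layer \<equiv> synthesis_layer p a b \<psi>"

definition synthesis_bound :: ennreal where
  "synthesis_bound = ennreal (inverse \<bar>det b\<bar>)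
    * eLp_norm p (lebesgue_on cell) (periodization b (\<lambda>x. ennreal (cmod (\<psi> x))))"

lemma synthesis_bound_finite: "synthesis_bound < \<infinity>"
  using eLp_norm_periodization_cell_finite[OF p periodization_loc]
  by (simp add: synthesis_bound_def ennreal_mult_less_top)

lemma affine_atom_measurable:
  assumes "0 < j"
  shows "affine_atom p a b \<psi> j k \<in> borel_measurable lebesgue"
  unfolding affine_atom_def[abs_def]
  using measurable_compose[OF measurable_affine_lebesgue[OF det_a[OF assms], of "- (b *v int_vec k)"] \<psi>]
  by simp

text \<open>The sum of the moduli of the terms of one layer. A single norm bound for it yields both
  the absolute convergence over k almost everywhere and the norm bound for the layer.\<close>

definition layer_majorant :: "(int ^ 'n \<Rightarrow> complex) \<Rightarrow> nat \<Rightarrow> real ^ 'n \<Rightarrow> ennreal" where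
  "layer_majorant s j x = (\<integral>\<^sup>+k. ennreal (cmod (s k * affine_atom p a b \<psi> j k x)) \<partial>count_space UNIV)"

lemma layer_majorant_measurable:
  assumes "0 < j"
  shows "layer_majorant s j \<in> borel_measurable lebesgue"
  unfolding layer_majorant_def[abs_def]
  using affine_atom_measurable[OF assms] by (intro borel_measurable_nn_integral_count_space) auto

lemma eLp_norm_layer_majorant_le:
  assumes j: "0 < j"
  shows "eLp_norm p lebesgue (layer_majorant s j) \<le> synthesis_bound * lp_norm p s"
proof -
  let ?w = "\<lambda>x. ennreal (cmod (\<psi> x))" and ?s = "\<lambda>k. ennreal (cmod (s k))"
  have w: "?w \<in> borel_measurable lebesgue"
    using \<psi> by measurable
  let ?g = "\<lambda>x. \<integral>\<^sup>+k. ?s k * ?w (x - b *v int_vec k) \<partial>count_space UNIV"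
  have g: "?g \<in> borel_measurable lebesgue"
    using measurable_lebesgue_translate(2)[OF w]
    by (intro borel_measurable_nn_integral_count_space borel_measurable_times_ennreal) auto
  \<comment> \<open>The layer is the normalized dilate by \<open>a j\<close> of a lattice
    convolution \<open>?g\<close> that does not involve \<open>a j\<close>; this is why the bound is
    uniform in j.\<close>
  have "layer_majorant s j = (\<lambda>x. ennreal (\<bar>det (a j)\<bar> powr recip_exp p) * ?g (a j *v x))"
    by (simp add: fun_eq_iff layer_majorant_def affine_atom_def norm_mult ennreal_mult
        mult.left_commute flip: nn_integral_cmult)
  then have "eLp_norm p lebesgue (layer_majorant s j) \<le> eLp_norm p lebesgue ?g"
    using eLp_norm_dilation_le[OF p det_a[OF j] g] by simp
  also have "\<dots> \<le> lp_norm p s * eLp_norm p (lebesgue_on cell) (lattice_sum ?w)"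
    unfolding lp_norm_eq_eLp_norm[OF p] by (rule eLp_norm_lattice_convolution_le[OF p w])
  also have "\<dots> \<le> lp_norm p s * synthesis_bound"
    unfolding synthesis_bound_def using periodization_loc
    by (intro mult_left_mono eLp_norm_lattice_sum_le p) (auto simp: eLp_loc_def)
  finally show ?thesis
    by (simp add: mult.commute)
qed

lemma layer_measurable: "0 < j \<Longrightarrow> layer c j \<in> borel_measurable lebesgue"
  unfolding synthesis_layer_def[abs_def]
  using affine_atom_measurable by (intro borel_measurable_infsum_complex) auto

lemma Lp_norm_layer_le:
  assumes j: "0 < j"
  shows "Lp_norm p lebesgue (layer c j) \<le> synthesis_bound * lp_norm p (c j)"
proof -
  have "Lp_norm p lebesgue (layer c j) \<le> eLp_norm p lebesgue (layer_majorant (c j) j)"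
    unfolding Lp_norm_def
  proof (rule eLp_norm_mono_AE[OF p])
    show "(\<lambda>x. ennreal (cmod (layer c j x))) \<in> borel_measurable lebesgue"
      using layer_measurable[OF j, of c] by measurable
    show "AE x in lebesgue. ennreal (cmod (layer c j x)) \<le> layer_majorant (c j) j x"
      unfolding synthesis_layer_def layer_majorant_def by (intro AE_I2 norm_infsum_le_nn_integral)
  qed
  also have "\<dots> \<le> synthesis_bound * lp_norm p (c j)"
    by (rule eLp_norm_layer_majorant_le[OF j])
  finally show ?thesis .
qed

lemma lp_norm_finite: "c \<in> l1lp_space p \<Longrightarrow> 0 < j \<Longrightarrow> lp_norm p (c j) < \<infinity>"
  unfolding l1lp_space_def mem_Collect_eq by (rule le_less_trans[OF lp_norm_le_l1lp_norm])

lemma layer_in_Lp_space: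
  assumes "c \<in> l1lp_space p" "0 < j"
  shows "layer c j \<in> Lp_space p lebesgue"
proof -
  have "synthesis_bound * lp_norm p (c j) < \<infinity>"
    using lp_norm_finite[OF assms] synthesis_bound_finite by (simp add: ennreal_mult_less_top)
  with Lp_norm_layer_le[OF assms(2)] have "Lp_norm p lebesgue (layer c j) < \<infinity>"
    by (rule le_less_trans)
  with layer_measurable[OF assms(2)] show ?thesis
    by (simp add: Lp_space_iff)
qed

lemma AE_layer_summable:
  assumes "c \<in> l1lp_space p" "0 < j"
  shows "AE x in lebesgue. (\<lambda>k. cmod (c j k * affine_atom p a b \<psi> j k x)) summable_on UNIV"
proof -
  have "synthesis_bound * lp_norm p (c j) < \<infinity>"
    using lp_norm_finite[OF assms] synthesis_bound_finite by (simp add: ennreal_mult_less_top)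
  with eLp_norm_layer_majorant_le[OF assms(2)] have "eLp_norm p lebesgue (layer_majorant (c j) j) < \<infinity>"
    by (rule le_less_trans)
  then have "AE x in lebesgue. layer_majorant (c j) j x < \<infinity>"
    by (rule eLp_norm_finite_AE[OF p layer_majorant_measurable[OF assms(2)]])
  then show ?thesis
    unfolding layer_majorant_def summable_norm_iff_nn_integral .
qed

lemma infsum_Lp_norm_layer_le:
  "(\<Sum>\<^sub>\<infinity>j\<in>{0<..}. Lp_norm p lebesgue (layer c j)) \<le> synthesis_bound * l1lp_norm p c"
proof -
  have "(\<integral>\<^sup>+j. Lp_norm p lebesgue (layer c j) \<partial>count_space {0<..})
      \<le> (\<integral>\<^sup>+j. synthesis_bound * lp_norm p (c j) \<partial>count_space {0<..})"
    by (intro nn_integral_mono Lp_norm_layer_le) simp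
  also have "\<dots> = synthesis_bound * l1lp_norm p c"
    unfolding l1lp_norm_eq_nn_integral by (intro nn_integral_cmult) auto
  finally show ?thesis
    by (simp add: infsum_ennreal_eq_nn_integral)
qed

text \<open>A concrete representative of S c. Algebraic identities can be checked on it point by
  point, which the arbitrary choice in \<open>synthesis\<close> does not allow.\<close>

definition synthesis_pointwise :: "(nat \<Rightarrow> int ^ 'n \<Rightarrow> complex) \<Rightarrow> real ^ 'n \<Rightarrow> complex" where
  "synthesis_pointwise c x = (\<Sum>\<^sub>\<infinity>j\<in>{0<..}. layer c j x)"

context
  fixes c :: "nat \<Rightarrow> int ^ 'n \<Rightarrow> complex"
  assumes c: "c \<in> l1lp_space p"
begin

lemma infsum_Lp_norm_layer_finite: "(\<Sum>\<^sub>\<infinity>j\<in>{0<..}. Lp_norm p lebesgue (layer c j)) < \<infinity>"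
proof -
  have "synthesis_bound * l1lp_norm p c < \<infinity>"
    using c synthesis_bound_finite by (simp add: l1lp_space_def ennreal_mult_less_top)
  with infsum_Lp_norm_layer_le show ?thesis
    by (rule le_less_trans)
qed

lemma layer_sums:
  shows "AE x in lebesgue. (\<lambda>j. cmod (layer c j x)) summable_on {0<..}"
    and "Lp_abs_sums p lebesgue (layer c) (synthesis_pointwise c)"
    and "Lp_norm p lebesgue (synthesis_pointwise c) \<le> (\<Sum>\<^sub>\<infinity>j\<in>{0<..}. Lp_norm p lebesgue (layer c j))"
  unfolding synthesis_pointwise_def[abs_def]
  by (rule Lp_abs_sums_infsum[OF p layer_in_Lp_space[OF c] infsum_Lp_norm_layer_finite], assumption)+

lemma synthesis_sums: "Lp_abs_sums p lebesgue (layer c) (synthesis p a b \<psi> c)"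
  unfolding synthesis_def by (rule someI[of "Lp_abs_sums p lebesgue (layer c)"]) (rule layer_sums(2))

lemma AE_synthesis_eq: "AE x in lebesgue. synthesis p a b \<psi> c x = synthesis_pointwise c x"
  by (rule Lp_abs_sums_unique[OF p synthesis_sums layer_sums(2)])

lemma synthesis_in_Lp_space: "synthesis p a b \<psi> c \<in> Lp_space p lebesgue"
  using synthesis_sums by (simp add: Lp_abs_sums_def)

lemma Lp_norm_synthesis_le: "Lp_norm p lebesgue (synthesis p a b \<psi> c) \<le> synthesis_bound * l1lp_norm p c"
proof -
  have "Lp_norm p lebesgue (synthesis p a b \<psi> c) = Lp_norm p lebesgue (synthesis_pointwise c)"
    unfolding Lp_norm_def
  proof (rule eLp_norm_cong_AE[OF p])
    show "AE x in lebesgue. ennreal (cmod (synthesis p a b \<psi> c x)) = ennreal (cmod (synthesis_pointwise c x))"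
      using AE_synthesis_eq by eventually_elim simp
  qed (use synthesis_sums layer_sums(2) in \<open>auto simp: Lp_abs_sums_def Lp_space_iff\<close>)
  also have "\<dots> \<le> synthesis_bound * l1lp_norm p c"
    using layer_sums(3) infsum_Lp_norm_layer_le by (rule order.trans)
  finally show ?thesis .
qed

text \<open>Additivity of \<open>infsum\<close> rests on summability, over j and, for each j, over
  k. Countably many exceptional sets are merged so that all of this holds at one and the same
  x.\<close>

lemma AE_all_summable:
  "AE x in lebesgue. (\<lambda>j. layer c j x) summable_on {0<..} \<and>
    (\<forall>j>0. (\<lambda>k. c j k * affine_atom p a b \<psi> j k x) summable_on UNIV)"
proof -
  have "AE x in lebesgue. \<forall>j\<in>{0<..}. (\<lambda>k. cmod (c j k * affine_atom p a b \<psi> j k x)) summable_on UNIV"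
    unfolding AE_ball_countable[OF countable_subset[OF subset_UNIV countableI_type]]
    using AE_layer_summable[OF c] by blast
  with layer_sums(1) show ?thesis
    by eventually_elim (auto intro: abs_summable_summable)
qed

end

lemma synthesis_add:
  assumes c: "c \<in> l1lp_space p" and c': "c' \<in> l1lp_space p"
  shows "AE x in lebesgue. synthesis p a b \<psi> (\<lambda>j k. c j k + c' j k) x =
    synthesis p a b \<psi> c x + synthesis p a b \<psi> c' x"
  using AE_all_summable[OF c] AE_all_summable[OF c'] AE_synthesis_eq[OF c] AE_synthesis_eq[OF c']
    AE_synthesis_eq[OF l1lp_space_add[OF p c c']]
proof eventually_elim
  case (elim x)
  have "layer (\<lambda>j k. c j k + c' j k) j x = layer c j x + layer c' j x" if "j \<in> {0<..}" for j
    unfolding synthesis_layer_def distrib_right using elim that by (intro infsum_add) auto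
  then have "synthesis_pointwise (\<lambda>j k. c j k + c' j k) x = (\<Sum>\<^sub>\<infinity>j\<in>{0<..}. layer c j x + layer c' j x)"
    unfolding synthesis_pointwise_def by (rule infsum_cong)
  also have "\<dots> = synthesis_pointwise c x + synthesis_pointwise c' x"
    unfolding synthesis_pointwise_def using elim by (intro infsum_add) auto
  finally show ?case
    using elim by simp
qed

text \<open>Scaling by a complex number commutes with \<open>infsum\<close> even where the sum does
  not exist, so the only exceptional sets are those on which the chosen representatives differ from
  the pointwise sums.\<close>

lemma synthesis_cmult:
  assumes c: "c \<in> l1lp_space p"
  shows "AE x in lebesgue. synthesis p a b \<psi> (\<lambda>j k. z * c j k) x = z * synthesis p a b \<psi> c x"
  using AE_synthesis_eq[OF c] AE_synthesis_eq[OF l1lp_space_cmult[OF p c, of z]]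
  by eventually_elim
    (simp add: synthesis_pointwise_def synthesis_layer_def mult.assoc infsum_cmult_right')

lemma bounded_synthesis: "bounded_l1lp_Lp_operator p lebesgue (synthesis p a b \<psi>)"
proof -
  obtain B where "synthesis_bound = ennreal B"
    using synthesis_bound_finite by (cases synthesis_bound) auto
  then have "\<forall>c\<in>l1lp_space p. Lp_norm p lebesgue (synthesis p a b \<psi> c) \<le> ennreal B * l1lp_norm p c"
    using Lp_norm_synthesis_le by simp
  then show ?thesis
    unfolding bounded_l1lp_Lp_operator_def
    using synthesis_in_Lp_space synthesis_add synthesis_cmult by blast
qed

end

theorem theorem1:
  fixes a :: "nat \<Rightarrow> real ^ 'n ^ 'n"
    and b :: "real ^ 'n ^ 'n"
    and \<psi> :: "real ^ 'n \<Rightarrow> complex"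
    and p :: ennreal
  assumes "\<And>j. j > 0 \<Longrightarrow> invertible (a j)"
    and "expanding a"
    and "invertible b"
    and "1 \<le> p"
    and "\<psi> \<in> Lp_space p lebesgue"
    and "periodization b (\<lambda>x. ennreal (cmod (\<psi> x))) \<in> eLp_loc p"
  shows "bounded_l1lp_Lp_operator p lebesgue (synthesis p a b \<psi>) \<and>
    (\<forall>c\<in>l1lp_space p.
      (\<forall>j>0. (AE x in lebesgue. (\<lambda>k. cmod (c j k * affine_atom p a b \<psi> j k x)) summable_on UNIV) \<and>
              synthesis_layer p a b \<psi> c j \<in> Lp_space p lebesgue) \<and>
      Lp_abs_sums p lebesgue (synthesis_layer p a b \<psi> c) (synthesis p a b \<psi> c) \<and>
      Lp_norm p lebesgue (synthesis p a b \<psi> c)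
        \<le> ennreal (inverse \<bar>det b\<bar>)
          * eLp_norm p (lebesgue_on ((*v) b ` unit_cube)) (periodization b (\<lambda>x. ennreal (cmod (\<psi> x))))
          * l1lp_norm p c)"
proof -
  interpret synthesis_setting b a \<psi> p
    using assms by unfold_locales (auto simp: invertible_det_nz Lp_space_iff)
  show ?thesis
    using bounded_synthesis AE_layer_summable layer_in_Lp_space synthesis_sums Lp_norm_synthesis_le
    unfolding synthesis_bound_def by blast
qed

end
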